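(* Let $\mathcal{H}$ be a hypergraph with $|V(\mathcal{H})|=n$ and let $\sigma:[n]\to V(\mathcal{H})$ be an arbitrary bijection. Let $d,q,r,t$ be positive integers with $r\geq 2$ and $q\geq (d-1)(t-1)+1$. Then any coloring of the vertices of $\operatorname{KG}^r(\mathcal{H})$ with no monochromatic $K^r_{t,\dots,t}$ subhypergraph uses at least $$\min\left\{\left\lceil\frac{n-\operatorname{alt}_r(\mathcal{H},\sigma,q)}{r-1}\right\rceil,\, d\right\}$$ colors.
   Context: A hypergraph $\mathcal{H}$ has a finite nonempty vertex set and a family $E(\mathcal{H})$ of distinct nonempty subsets (edges). For $S\subseteq V(\mathcal{H})$, $\mathcal{H}[S]$ is the induced subhypergraph on $S$ (edges of $\mathcal{H}$ contained in $S$). For $r\ge2$, $\operatorname{KG}^r(\mathcal{H})$ has vertex set $E(\mathcal{H})$ and edges the $r$-sets of pairwise disjoint edges of $\mathcal{H}$. $K^r_{t,\dots,t}$ is the complete $r$-uniform $r$-partite hypergraph with parts of size $t$; a $K^r_{t,\dots,t}$ subhypergraph of an $r$-uniform hypergraph $\mathcal{G}$ is given by pairwise disjoint $t$-sets $W_1,\dots,W_r\subseteq V(\mathcal{G})$ such that every set $\{w_1,\dots,w_r\}$ with $w_i\in W_i$ is an edge of $\mathcal{G}$; it is monochromatic if all vertices in $W_1\cup\dots\cup W_r$ receive the same color. Alternation number: let $\mathbb{Z}_r=\{\omega^1,\dots,\omega^r\}$ be cyclic of order $r$. For $X=(x_1,\dots,x_n)\in(\mathbb{Z}_r\cup\{0\})^n$,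 $\operatorname{alt}(X)$ is the maximum length of a subsequence $x_{i_1},\dots,x_{i_k}$ ($i_1<\dots<i_k$) of nonzero entries with consecutive terms distinct ($\operatorname{alt}(0,\dots,0)=0$), and $X^i=\{j: x_j=\omega^i\}$. Then $\operatorname{alt}_r(\mathcal{H},\sigma,q)=\max\{\operatorname{alt}(X): X\in(\mathbb{Z}_r\cup\{0\})^n,\ |E(\mathcal{H}[\sigma(X^i)])|\leq q-1\ \forall i\in[r]\}$. *)

theory Defs
  imports Complex_Main "HOL-Library.Disjoint_Sets"
begin

type_synonym 'a hypergraph = "'a set \<times> 'a set set"

abbreviation verts :: "'a hypergraph \<Rightarrow> 'a set" where "verts \<equiv> fst"

abbreviation edges :: "'a hypergraph \<Rightarrow> 'a set set" where "edges \<equiv> snd"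

definition hypergraph :: "'a hypergraph \<Rightarrow> bool" where
  "hypergraph H \<longleftrightarrow> finite (verts H) \<and> verts H \<noteq> {} \<and>
     (\<forall>e \<in> edges H. e \<noteq> {} \<and> e \<subseteq> verts H)"

definition induced :: "'a hypergraph \<Rightarrow> 'a set \<Rightarrow> 'a hypergraph" where
  "induced H S = (S, {e \<in> edges H. e \<subseteq> S})"

definition KG :: "nat \<Rightarrow> 'a hypergraph \<Rightarrow> 'a set hypergraph" where
  "KG r H = (edges H, {F. F \<subseteq> edges H \<and> finite F \<and> card F = r \<and> pairwise disjnt F})"

text \<open>The parts \<open>W 1, \<dots>, W r\<close> span a complete \<open>r\<close>-partite subhypergraph
  of \<open>G\<close> with all parts of size \<open>t\<close>.\<close>

definition complete_partite_sub ::
    "nat \<Rightarrow> nat \<Rightarrow> 'v hypergraph \<Rightarrow> (nat \<Rightarrow> 'v set) \<Rightarrow> bool" where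
  "complete_partite_sub r t G W \<longleftrightarrow>
     (\<forall>i \<in> {1..r}. W i \<subseteq> verts G \<and> finite (W i) \<and> card (W i) = t) \<and>
     disjoint_family_on W {1..r} \<and>
     (\<forall>w. (\<forall>i \<in> {1..r}. w i \<in> W i) \<longrightarrow> w ` {1..r} \<in> edges G)"

definition monochromatic :: "('v \<Rightarrow> 'c) \<Rightarrow> 'v set \<Rightarrow> bool" where
  "monochromatic c S \<longleftrightarrow> (\<exists>k. \<forall>v \<in> S. c v = k)"

text \<open>A vector over \<open>\<int>\<^sub>r \<union> {0}\<close> of length \<open>n\<close> is a function from \<open>{1..n}\<close> to
  \<open>{0..r}\<close>: the value \<open>i \<in> {1..r}\<close> stands for the group element \<open>\<omega>\<^sup>i\<close> (so \<open>r\<close>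
  is the identity), and \<open>0\<close> for the extra symbol.\<close>

definition alt :: "nat \<Rightarrow> (nat \<Rightarrow> nat) \<Rightarrow> nat" where
  "alt n X = Max {length js | js. sorted_wrt (<) js \<and> set js \<subseteq> {1..n} \<and>
     (\<forall>j \<in> set js. X j \<noteq> 0) \<and> distinct_adj (map X js)}"

definition alt_number :: "nat \<Rightarrow> 'a hypergraph \<Rightarrow> (nat \<Rightarrow> 'a) \<Rightarrow> nat \<Rightarrow> nat" where
  "alt_number r H \<sigma> q = (let n = card (verts H) in
     Max {alt n X | X. X \<in> {1..n} \<rightarrow>\<^sub>E {0..r} \<and>
       (\<forall>i \<in> {1..r}. card (edges (induced H (\<sigma> ` {j \<in> {1..n}. X j = i}))) \<le> q - 1)})"

end

theory Submission
  imports Defs "HOL-Number_Theory.Cong"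
begin

text \<open>For \<open>k\<close> a colour let \<open>F k\<close> be the family of index sets \<open>B\<close> such that \<open>\<sigma>(B)\<close> contains \<open>t\<close>
  edges of colour \<open>k\<close>. No \<open>r\<close> members of \<open>F k\<close> are disjoint, and a set containing no member of any
  \<open>F k\<close> spans at most \<open>C (t - 1) < q\<close> edges when \<open>C < d\<close> colours are used. So it suffices to find
  an alternating vector with at least \<open>n - (r - 1) C\<close> nonzero entries none of whose classes contains a
  member of an \<open>F k\<close>. This property of \<open>r\<close> is multiplicative, which leaves the case of a prime.

  For a prime \<open>p\<close>, a nonzero vector \<open>X\<close> has a height: its alternation number if its classes avoid all
  \<open>F k\<close>, and otherwise a number built from the largest colour \<open>k\<close> that is hit and the size of the
  nonempty proper set \<open>S \<subset> \<int>\<^sub>p\<close> of classes hitting \<open>F k\<close>. Heights are monotone, and comparable vectors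
  of equal height have the same label in \<open>\<int>\<^sub>p\<close> (the first entry, respectively the mean of \<open>S\<close>), where
  labels are equivariant. But every equivariant labelling of the nonzero vectors has a maximal
  chain in which neighbouring labels differ. If the wanted vector did not exist, the heights along this
  chain would be \<open>n\<close> distinct numbers in \<open>{1..n - 1}\<close>.

  The chain exists for cohomological reasons: pulling back normalized cochains of the cyclic
  group along the labelling, one gets a nonzero value on the explicit chain that generates the top
  dimension, while a normalized cochain vanishes on lists with equal neighbours.\<close>

section \<open>Normalized cochains\<close>

text \<open>Coefficients: \<open>\<rat>/\<int>\<close> contains elements of every finite order, so one type serves all \<open>r\<close>.\<close>

quotient_type rat_mod_int = rat / "\<lambda>x y :: rat. x - y \<in> \<int>"
proof (rule equivpI)
  show "reflp (\<lambda>x y :: rat. x - y \<in> \<int>)"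
    by (auto intro: reflpI)
  show "symp (\<lambda>x y :: rat. x - y \<in> \<int>)"
    by (auto intro!: sympI) (metis Ints_minus minus_diff_eq)
  show "transp (\<lambda>x y :: rat. x - y \<in> \<int>)"
    by (auto intro!: transpI) (metis Ints_add diff_add_cancel add_diff_eq)
qed

instantiation rat_mod_int :: ab_group_add
begin

lift_definition zero_rat_mod_int :: rat_mod_int is 0 .

lift_definition plus_rat_mod_int :: "rat_mod_int \<Rightarrow> rat_mod_int \<Rightarrow> rat_mod_int" is "(+)"
  by (metis Ints_add add_diff_add)

lift_definition minus_rat_mod_int :: "rat_mod_int \<Rightarrow> rat_mod_int \<Rightarrow> rat_mod_int" is "(-)"
  by (metis (no_types, opaque_lifting) Ints_diff diff_diff_eq2 diff_diff_eq add.commute add_diff_eq)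

lift_definition uminus_rat_mod_int :: "rat_mod_int \<Rightarrow> rat_mod_int" is uminus
  by (metis Ints_minus minus_diff_eq minus_diff_minus)

instance
  by standard (transfer; simp)+

end

text \<open>The class of \<open>1 / r\<close>. It supplies the nonzero constant annihilated by the
  norm from which the induction over degrees starts.\<close>

lemma ex_torsion_rat_mod_int:
  fixes r :: nat
  assumes "r \<ge> 2"
  obtains z :: rat_mod_int where "z \<noteq> 0" "(\<Sum>i<r. z) = 0"
proof
  define z where "z = abs_rat_mod_int (1 / of_nat r)"
  have "1 / (of_nat r :: rat) \<notin> \<int>"
  proof
    assume "1 / (of_nat r :: rat) \<in> \<int>"
    then obtain k where "1 / (of_nat r :: rat) = of_int k"
      by (elim Ints_cases)
    then have "of_int (k * int r) = (of_int 1 :: rat)"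
      using assms by (simp add: field_simps)
    then have "k * int r = 1"
      by (simp only: of_int_eq_iff)
    then show False
      using assms by (simp add: zmult_eq_1_iff)
  qed
  then show "z \<noteq> 0"
    unfolding z_def zero_rat_mod_int_def by (simp add: rat_mod_int.abs_eq_iff)
  have "(\<Sum>i<m. z) = abs_rat_mod_int (of_nat m / of_nat r)" for m
  proof (induction m)
    case 0
    show ?case by (simp add: zero_rat_mod_int_def)
  next
    case (Suc m)
    then show ?case
      by (simp add: z_def plus_rat_mod_int.abs_eq add_divide_distrib add.commute)
  qed
  from this[of r] show "(\<Sum>i<r. z) = 0"
    using assms by (simp add: zero_rat_mod_int_def rat_mod_int.abs_eq_iff)
qed

text \<open>Unfolding the recursion gives the alternating sum of \<open>F\<close> over all deletions
  of one entry. As the value at \<open>[x]\<close> is \<open>F []\<close>, the complex is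
  augmented.\<close>

fun coboundary :: "('v list \<Rightarrow> 'g :: ab_group_add) \<Rightarrow> 'v list \<Rightarrow> 'g" where
  "coboundary F [] = 0"
| "coboundary F (x # xs) = F xs - coboundary (\<lambda>ys. F (x # ys)) xs"

lemma coboundary_zero [simp]: "coboundary (\<lambda>_. 0) xs = 0"
  by (induction xs) auto

lemma coboundary_add:
  "coboundary (\<lambda>xs. F xs + G xs) xs = coboundary F xs + coboundary G xs"
  by (induction xs arbitrary: F G) (auto simp: algebra_simps)

lemma coboundary_diff:
  "coboundary (\<lambda>xs. F xs - G xs) xs = coboundary F xs - coboundary G xs"
  by (induction xs arbitrary: F G) (auto simp: algebra_simps)

lemma coboundary_sum:
  "coboundary (\<lambda>xs. \<Sum>i<m. F i xs) xs = (\<Sum>i<(m::nat). coboundary (F i) xs)"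
  by (induction m) (auto simp: coboundary_add)

lemma coboundary_map:
  "coboundary F (map h xs) = coboundary (\<lambda>ys. F (map h ys)) xs"
  by (induction xs arbitrary: F) auto

lemma coboundary_coboundary [simp]: "coboundary (coboundary F) xs = 0"
  by (induction xs arbitrary: F) (auto simp: coboundary_diff)

text \<open>Deleting either of two equal adjacent entries gives the same list with opposite signs,
  and every other deletion keeps the pair.\<close>

lemma coboundary_normalized:
  assumes "\<And>xs. \<not> distinct_adj xs \<Longrightarrow> F xs = 0" and "\<not> distinct_adj xs"
  shows "coboundary F xs = 0"
  using assms
proof (induction xs arbitrary: F)
  case Nil
  then show ?case by simp
next
  case (Cons x xs)
  show ?case
  proof (cases "distinct_adj xs")
    case False
    then have "coboundary (\<lambda>ys. F (x # ys)) xs = 0"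
      by (intro Cons.IH Cons.prems(1)) (auto simp: distinct_adj_Cons)
    with False show ?thesis
      by (simp add: Cons.prems(1))
  next
    case True
    with Cons.prems(2) obtain ys where ys: "xs = x # ys"
      by (cases xs) (auto simp: distinct_adj_Cons)
    have "(\<lambda>zs. F (x # x # zs)) = (\<lambda>_. 0)"
      by (intro ext Cons.prems(1)) auto
    then show ?thesis
      by (simp add: ys)
  qed
qed

text \<open>Dual of the prism operator: the listed chains are
  \<open>x\<^sub>0, \<dots>, x\<^sub>i, a x\<^sub>i, \<dots>, a x\<^sub>k\<close> together with \<open>a y, a x\<^sub>0, \<dots>, a x\<^sub>k\<close>. For \<open>a\<close> filling
  a fresh coordinate and \<open>y\<close> the zero vector this cones off a chain in the order complex.\<close>

fun cone :: "('v \<Rightarrow> 'v) \<Rightarrow> ('v list \<Rightarrow> 'g :: ab_group_add) \<Rightarrow> 'v \<Rightarrow> 'v list \<Rightarrow> 'g" where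
  "cone a F y [] = F [a y]"
| "cone a F y (x # xs) = F (a y # map a (x # xs)) - cone a (\<lambda>zs. F (x # zs)) x xs"

lemma cone_diff: "cone a (\<lambda>xs. F xs - G xs) y xs = cone a F y xs - cone a G y xs"
  by (induction xs arbitrary: F G y) (auto simp: algebra_simps)

text \<open>Only the leading summand of \<open>cone\<close> depends on the base point. This lets the
  induction for \<open>cone_coboundary\<close> pass from the base \<open>x\<close> back to
  \<open>y\<close>.\<close>

lemma cone_change_base:
  "cone a F x xs - cone a F y xs = F (a x # map a xs) - F (a y # map a xs)"
  by (cases xs) auto

text \<open>A contracting homotopy: the prism part deforms the identity into the action of
  \<open>a\<close>, and the summand starting with \<open>a y\<close> cones this image off.\<close>

lemma cone_coboundary:
  "cone a (coboundary F) y xs = F xs - coboundary (cone a F y) xs"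
proof (induction xs arbitrary: F y)
  case Nil
  show ?case by simp
next
  case (Cons x xs)
  let ?Fx = "\<lambda>zs. F (x # zs)"
  let ?G = "\<lambda>zs. F (a y # a x # zs)"
  have "cone a (coboundary F) y (x # xs)
      = coboundary F (a y # a x # map a xs) - cone a (\<lambda>zs. F zs - coboundary ?Fx zs) x xs"
    by simp
  also have "\<dots> = F (a x # map a xs) - F (a y # map a xs) + coboundary ?G (map a xs)
      - cone a F x xs + F (x # xs) - coboundary (cone a ?Fx x) xs"
    by (simp add: cone_diff Cons.IH algebra_simps)
  also have "\<dots> = F (x # xs) - (cone a F y xs
      - coboundary (\<lambda>ys. F (a y # a x # map a ys) - cone a ?Fx x ys) xs)"
    using cone_change_base[of a F x xs y]
    by (simp add: coboundary_diff coboundary_map algebra_simps)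
  finally show ?case by simp
qed

text \<open>Alternately \<open>g - 1\<close> and the norm \<open>1 + g + \<dots> + g\<^sup>r\<^sup>-\<^sup>1\<close>, whose products vanish.\<close>

definition twist ::
    "('v \<Rightarrow> 'v) \<Rightarrow> nat \<Rightarrow> nat \<Rightarrow> ('v list \<Rightarrow> 'g :: ab_group_add) \<Rightarrow> 'v list \<Rightarrow> 'g" where
  "twist g r k F xs =
     (if even k then F (map g xs) - F xs else (\<Sum>i<r. F (map (g ^^ i) xs)))"

lemma twist_diff: "twist g r k (\<lambda>xs. F xs - G xs) xs = twist g r k F xs - twist g r k G xs"
  by (simp add: twist_def sum_subtractf)

lemma coboundary_twist: "coboundary (twist g r k F) xs = twist g r k (coboundary F) xs"
proof (cases "even k")
  case True
  then show ?thesis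
    by (simp add: twist_def[abs_def] coboundary_diff coboundary_map)
next
  case False
  then show ?thesis
    by (simp add: twist_def[abs_def] coboundary_sum coboundary_map)
qed

lemma twist_twist:
  assumes "\<And>xs. F (map (g ^^ r) xs) = F xs"
  shows "twist g r k (twist g r (Suc k) F) xs = 0"
proof -
  have "(\<Sum>i<r. F (map (g ^^ Suc i) xs) - F (map (g ^^ i) xs)) = F (map (g ^^ r) xs) - F xs"
    by (subst sum_lessThan_telescope) simp
  then have tel: "(\<Sum>i<r. F (map (g ^^ Suc i) xs) - F (map (g ^^ i) xs)) = 0"
    using assms by simp
  show ?thesis
  proof (cases "even k")
    case True
    have "(\<Sum>i<r. F (map (g ^^ i) (map g xs))) = (\<Sum>i<r. F (map (g ^^ Suc i) xs))"
      by (simp add: funpow_swap1 o_def)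
    with tel True show ?thesis
      by (simp add: twist_def sum_subtractf)
  next
    case False
    have "twist g r k (twist g r (Suc k) F) xs
        = (\<Sum>i<r. F (map (g ^^ Suc i) xs) - F (map (g ^^ i) xs))"
      using False by (simp add: twist_def o_def)
    with tel show ?thesis by simp
  qed
qed

text \<open>The pairing of \<open>F\<close> with a chain c_k that is never written down: c_0 is the
  point \<open>a 0 z\<close>, and c_(k+1) is the cone by \<open>a (Suc k)\<close> over the twist of
  c_k. Cone and twist enter through their duals on cochains.\<close>

fun evaluate :: "('v \<Rightarrow> 'v) \<Rightarrow> nat \<Rightarrow> (nat \<Rightarrow> 'v \<Rightarrow> 'v) \<Rightarrow> 'v \<Rightarrow> nat \<Rightarrow>
    ('v list \<Rightarrow> 'g :: ab_group_add) \<Rightarrow> 'g" where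
  "evaluate g r a z 0 F = F [a 0 z]"
| "evaluate g r a z (Suc k) F = evaluate g r a z k (twist g r k (cone (a (Suc k)) F z))"

lemma evaluate_diff:
  "evaluate g r a z k (\<lambda>xs. F xs - G xs) = evaluate g r a z k F - evaluate g r a z k G"
proof (induction k arbitrary: F G)
  case 0
  show ?case by simp
next
  case (Suc k)
  have "twist g r k (cone (a (Suc k)) (\<lambda>xs. F xs - G xs) z)
     = (\<lambda>xs. twist g r k (cone (a (Suc k)) F z) xs - twist g r k (cone (a (Suc k)) G z) xs)"
    by (simp add: fun_eq_iff cone_diff[abs_def] twist_diff)
  with Suc show ?case by simp
qed

lemma evaluate_zero: "evaluate g r a z k (\<lambda>_. 0) = 0"
  using evaluate_diff[of g r a z k "\<lambda>_. 0" "\<lambda>_. 0"] by simp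

text \<open>In terms of chains, the boundary of c_(k+1) is the k-th twist of c_k. The boundary of a
  cone is its base minus the cone over the boundary of the base; in the inductive step this
  correction vanishes because consecutive twists annihilate each other.\<close>

lemma evaluate_coboundary:
  assumes "g ^^ r = id"
  shows "evaluate g r a z (Suc k) (coboundary F) = evaluate g r a z k (twist g r k F)"
proof (induction k arbitrary: F)
  case 0
  show ?case by (simp add: twist_def)
next
  case (Suc k)
  let ?G = "cone (a (Suc (Suc k))) F z"
  have "twist g r (Suc k) (cone (a (Suc (Suc k))) (coboundary F) z)
      = (\<lambda>xs. twist g r (Suc k) F xs - coboundary (twist g r (Suc k) ?G) xs)"
    by (simp add: fun_eq_iff cone_coboundary[abs_def] twist_diff coboundary_twist)
  then have "evaluate g r a z (Suc (Suc k)) (coboundary F)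
      = evaluate g r a z (Suc k) (twist g r (Suc k) F)
        - evaluate g r a z (Suc k) (coboundary (twist g r (Suc k) ?G))"
    unfolding evaluate.simps(2)[of g r a z "Suc k"] by (simp only: evaluate_diff)
  also have "evaluate g r a z (Suc k) (coboundary (twist g r (Suc k) ?G))
      = evaluate g r a z k (twist g r k (twist g r (Suc k) ?G))"
    by (rule Suc.IH)
  also have "twist g r k (twist g r (Suc k) ?G) = (\<lambda>_. 0)"
    by (rule HOL.ext, rule twist_twist) (simp add: assms)
  finally show ?case by (simp add: evaluate_zero)
qed

section \<open>Equivariant labellings of partial vectors\<close>

text \<open>Residues are represented by arbitrary integers, hence the periodicity clause.
  Translation fixes the empty list; the condition \<open>f [] = 0\<close> leaves only free orbits to
  consider.\<close>

definition cyclic_cochain :: "nat \<Rightarrow> (int list \<Rightarrow> 'g :: ab_group_add) \<Rightarrow> bool" where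
  "cyclic_cochain r f \<longleftrightarrow> f [] = 0 \<and> (\<forall>xs. f (map (\<lambda>a. a mod int r) xs) = f xs) \<and>
     (\<forall>xs. \<not> distinct_adj xs \<longrightarrow> f xs = 0)"

lemma cyclic_cochain_coboundary:
  assumes "cyclic_cochain r f"
  shows "cyclic_cochain r (coboundary f)"
  using assms by (auto simp: cyclic_cochain_def coboundary_map intro: coboundary_normalized)

lemma cyclic_cochain_cong:
  assumes "cyclic_cochain r f" and "\<And>x. x \<in> set xs \<Longrightarrow> h x mod int r = h' x mod int r"
  shows "f (map h xs) = f (map h' xs)"
proof -
  have "f (map h xs) = f (map (\<lambda>a. a mod int r) (map h xs))"
    using assms(1) by (simp add: cyclic_cochain_def del: map_map)
  also have "map (\<lambda>a. a mod int r) (map h xs) = map (\<lambda>a. a mod int r) (map h' xs)"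
    using assms(2) by simp
  also have "f \<dots> = f (map h' xs)"
    using assms(1) by (simp add: cyclic_cochain_def del: map_map)
  finally show ?thesis .
qed

lemma funpow_plus_1: "((\<lambda>a :: int. a + 1) ^^ i) = (\<lambda>a. a + int i)"
  by (induction i) auto

text \<open>The action is free, so the kernel of each twist is the image of the other one; the
  preimages are read off from the first entry of a list.\<close>

lemma cyclic_cochain_untwist:
  assumes r: "r \<ge> 1" and f: "cyclic_cochain r f"
    and z: "twist (\<lambda>a. a + 1) r (Suc k) f = (\<lambda>_. 0)"
  obtains u where "cyclic_cochain r u" "twist (\<lambda>a. a + 1) r k u = f"
proof (cases "even k")
  case True
  \<comment> \<open>The twist to be inverted is a difference. Let \<open>h\<close> be the residue of
    the head and sum \<open>f\<close> over the translates with heads below \<open>h\<close>: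
    translating \<open>xs\<close> by one adds the term with head \<open>h\<close>, which is
    \<open>f xs\<close>.\<close>
  define u where "u xs = (if xs = [] then 0 else
    \<Sum>j<nat (hd xs mod int r). f (map (\<lambda>x. x - hd xs + int j) xs))" for xs
  have "u (map (\<lambda>a. a mod int r) xs) = u xs" for xs
  proof (cases "xs = []")
    case False
    have "f (map (\<lambda>x. x mod int r - hd xs mod int r + int j) xs)
        = f (map (\<lambda>x. x - hd xs + int j) xs)" for j
      by (rule cyclic_cochain_cong[OF f]) (metis mod_add_left_eq mod_diff_eq)
    with False show ?thesis
      by (simp add: u_def hd_map o_def)
  qed (simp add: u_def)
  moreover have "u xs = 0" if "\<not> distinct_adj xs" for xs
  proof -
    have "\<not> distinct_adj (map (\<lambda>x. x - hd xs + int j) xs)" for j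
      using that by (subst distinct_adj_map_iff) (auto simp: inj_on_def)
    then show ?thesis
      using f by (simp add: u_def cyclic_cochain_def)
  qed
  ultimately have u: "cyclic_cochain r u"
    by (simp add: cyclic_cochain_def u_def)
  have "u (map (\<lambda>a. a + 1) xs) - u xs = f xs" for xs
  proof (cases "xs = []")
    case True
    then show ?thesis using f by (simp add: u_def cyclic_cochain_def)
  next
    case False
    define v where "v j = f (map (\<lambda>x. x - hd xs + int j) xs)" for j
    define h where "h = nat (hd xs mod int r)"
    have h: "int h = hd xs mod int r" "h < r"
      using r by (auto simp: h_def nat_less_iff)
    have "twist (\<lambda>a. a + 1) r (Suc k) f (map (\<lambda>x. x - hd xs) xs) = 0"
      by (simp add: z)
    then have v0: "(\<Sum>j<r. v j) = 0"
      using \<open>even k\<close> by (simp add: twist_def funpow_plus_1 v_def o_def)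
    have vh: "v h = f xs"
      unfolding v_def using cyclic_cochain_cong[OF f, of xs "\<lambda>x. x - hd xs + int h" "\<lambda>x. x"]
      by (simp add: h mod_simps)
    have ux: "u xs = (\<Sum>j<h. v j)"
      using False by (simp add: u_def v_def h_def)
    have ux1: "u (map (\<lambda>a. a + 1) xs) = (\<Sum>j<nat ((hd xs + 1) mod int r). v j)"
      using False by (simp add: u_def v_def hd_map o_def algebra_simps)
    have mod1: "(hd xs + 1) mod int r = (int h + 1) mod int r"
      by (simp add: h mod_simps)
    show ?thesis
    proof (cases "Suc h < r")
      case True
      then have "nat ((hd xs + 1) mod int r) = Suc h"
        unfolding mod1 by (simp add: mod_pos_pos_trivial)
      then show ?thesis
        by (simp add: ux ux1 vh)
    next
      \<comment> \<open>The head wraps around to \<open>0\<close> and the new sum is empty; the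
        vanishing norm of \<open>f\<close> supplies the missing term.\<close>
      case False
      with h have "r = Suc h" by simp
      then have "nat ((hd xs + 1) mod int r) = 0"
        unfolding mod1 by (simp add: add.commute)
      with v0 show ?thesis
        by (simp add: ux ux1 vh[symmetric] \<open>r = Suc h\<close>) (metis add.commute minus_unique)
    qed
  qed
  then have "twist (\<lambda>a. a + 1) r k u = f"
    using True by (simp add: twist_def fun_eq_iff)
  with u show ?thesis by (rule that)
next
  case False
  \<comment> \<open>Here \<open>f\<close> is translation invariant and must be written as a norm.
    Among the \<open>r\<close> translates of a nonempty list exactly one has a head divisible by
    \<open>r\<close>, and \<open>u\<close> keeps \<open>f\<close> only there.\<close>
  define u where "u xs = (if xs \<noteq> [] \<and> int r dvd hd xs then f xs else 0)" for xs
  have u: "cyclic_cochain r u"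
    using f by (auto simp: cyclic_cochain_def u_def hd_map dvd_mod_iff)
  have shift1: "f (map (\<lambda>a. a + 1) xs) = f xs" for xs
    using fun_cong[OF z, of xs] False by (simp add: twist_def)
  have shift: "f (map (\<lambda>a. a + int i) xs) = f xs" for i xs
  proof (induction i)
    case (Suc i)
    show ?case
      using shift1[of "map (\<lambda>a. a + int i) xs"] Suc by (simp add: o_def add_ac)
  qed simp
  have "(\<Sum>i<r. u (map (\<lambda>a. a + int i) xs)) = f xs" for xs
  proof (cases "xs = []")
    case True
    then show ?thesis using f by (simp add: u_def cyclic_cochain_def)
  next
    case False
    define m where "m = nat ((- hd xs) mod int r)"
    have m: "int m = (- hd xs) mod int r" "m < r"
      using r by (auto simp: m_def nat_less_iff)
    have "int r dvd hd xs + int i \<longleftrightarrow> i = m" if "i < r" for i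
    proof
      assume "i = m"
      then show "int r dvd hd xs + int i"
        by (simp add: m dvd_eq_mod_eq_0 mod_simps)
    next
      assume "int r dvd hd xs + int i"
      then have "int r dvd (int i - (- hd xs))"
        by (simp add: add.commute)
      then have "int i mod int r = (- hd xs) mod int r"
        by (simp only: mod_eq_dvd_iff)
      with that m show "i = m" by simp
    qed
    then have "(\<Sum>i<r. u (map (\<lambda>a. a + int i) xs)) = (\<Sum>i<r. if i = m then f xs else 0)"
      using False by (intro sum.cong) (auto simp: u_def hd_map shift)
    with m show ?thesis by simp
  qed
  then have "twist (\<lambda>a. a + 1) r k u = f"
    using False by (simp add: twist_def fun_eq_iff funpow_plus_1)
  with u show ?thesis by (rule that)
qed

section \<open>The cyclic action on symbols and vectors\<close>

definition rotate_symbol :: "nat \<Rightarrow> nat \<Rightarrow> nat" where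
  "rotate_symbol r a = (if a = 0 \<or> a > r then a else if a = r then 1 else a + 1)"

lemma rotate_symbol_0 [simp]: "rotate_symbol r 0 = 0"
  by (simp add: rotate_symbol_def)

lemma rotate_symbol_eq_0 [simp]: "rotate_symbol r a = 0 \<longleftrightarrow> a = 0"
  by (auto simp: rotate_symbol_def)

lemma rotate_symbol_gt_0 [simp]: "0 < rotate_symbol r a \<longleftrightarrow> 0 < a"
  by (auto simp: rotate_symbol_def)

lemma rotate_symbol_le [simp]: "rotate_symbol r a \<le> r \<longleftrightarrow> a \<le> r"
  by (auto simp: rotate_symbol_def)

lemma inj_rotate_symbol: "inj (rotate_symbol r)"
  by (auto simp: inj_on_def rotate_symbol_def split: if_splits)

lemma rotate_symbol_image: "rotate_symbol r ` {1..r} = {1..r}"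
proof (rule endo_inj_surj)
  show "inj_on (rotate_symbol r) {1..r}"
    using inj_rotate_symbol inj_on_subset by blast
qed (auto simp: rotate_symbol_def)

lemma funpow_rotate_symbol: "rotate_symbol r ^^ r = id"
proof
  fix a
  show "(rotate_symbol r ^^ r) a = id a"
  proof (cases "a = 0 \<or> a > r")
    case True
    then have "(rotate_symbol r ^^ i) a = a" for i
      by (induction i) (auto simp: rotate_symbol_def)
    then show ?thesis by simp
  next
    case False
    then obtain b where b: "a = Suc b" "b < r"
      by (cases a) auto
    have "(rotate_symbol r ^^ i) (Suc b) = Suc ((b + i) mod r)" for i
    proof (induction i)
      case (Suc i)
      have "(b + i) mod r < r"
        using b by simp
      with Suc show ?case
        by (auto simp: rotate_symbol_def mod_Suc)
    qed (use b in simp)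
    with b show ?thesis by simp
  qed
qed

abbreviation rotate_vec :: "nat \<Rightarrow> ('i \<Rightarrow> nat) \<Rightarrow> 'i \<Rightarrow> nat" where
  "rotate_vec r X \<equiv> rotate_symbol r \<circ> X"

lemma funpow_rotate_vec: "rotate_vec r ^^ r = id"
proof -
  have "(rotate_vec r ^^ i) X = (rotate_symbol r ^^ i) \<circ> X" for i and X :: "'a \<Rightarrow> nat"
    by (induction i) auto
  then show ?thesis by (simp add: funpow_rotate_symbol fun_eq_iff)
qed

section \<open>Chains of partial vectors\<close>

definition partial_vecs :: "nat \<Rightarrow> 'i set \<Rightarrow> ('i \<Rightarrow> nat) set" where
  "partial_vecs r A = {X. \<forall>i. X i \<le> r \<and> (X i \<noteq> 0 \<longrightarrow> i \<in> A)}"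

lemma partial_vecs_mono: "A \<subseteq> B \<Longrightarrow> partial_vecs r A \<subseteq> partial_vecs r B"
  by (auto simp: partial_vecs_def)

definition extended_by :: "('i \<Rightarrow> nat) \<Rightarrow> ('i \<Rightarrow> nat) \<Rightarrow> bool" (infix "\<sqsubset>" 50) where
  "X \<sqsubset> Y \<longleftrightarrow> X \<noteq> Y \<and> (\<forall>i. X i \<noteq> 0 \<longrightarrow> Y i = X i)"

lemma extended_by_trans: "X \<sqsubset> Y \<Longrightarrow> Y \<sqsubset> Z \<Longrightarrow> X \<sqsubset> Z"
  unfolding extended_by_def by (metis ext)

lemma zero_extended_by [simp]: "(\<lambda>_. 0) \<sqsubset> X \<longleftrightarrow> X \<noteq> (\<lambda>_. 0)"
  by (auto simp: extended_by_def)

lemma extended_by_rotate: "rotate_vec r X \<sqsubset> rotate_vec r Y \<longleftrightarrow> X \<sqsubset> Y"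
  using inj_eq[OF inj_rotate_symbol[of r]] by (simp add: extended_by_def fun_eq_iff)

text \<open>The zero vector is excluded by prefixing it to the chain.\<close>

definition vec_chains :: "nat \<Rightarrow> 'i set \<Rightarrow> nat \<Rightarrow> ('i \<Rightarrow> nat) list set" where
  "vec_chains r A m = {xs. length xs = m \<and> sorted_wrt (\<sqsubset>) ((\<lambda>_. 0) # xs) \<and>
     set xs \<subseteq> partial_vecs r A}"

lemma rotate_partial_vecs: "rotate_vec r X \<in> partial_vecs r A \<longleftrightarrow> X \<in> partial_vecs r A"
  by (auto simp: partial_vecs_def)

lemma rotate_eq_zero: "rotate_vec r X = (\<lambda>_. 0) \<longleftrightarrow> X = (\<lambda>_. 0)"
  by (auto simp: fun_eq_iff)

lemma vec_chains_rotate: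
  assumes "xs \<in> vec_chains r A m"
  shows "map (rotate_vec r) xs \<in> vec_chains r A m"
proof -
  have "sorted_wrt (\<sqsubset>) (map (rotate_vec r) xs)"
    using assms by (simp add: vec_chains_def sorted_wrt_map extended_by_rotate)
  then show ?thesis
    using assms by (auto simp: vec_chains_def rotate_partial_vecs rotate_eq_zero)
qed

lemma vec_chains_funpow_rotate:
  assumes "xs \<in> vec_chains r A m"
  shows "map (rotate_vec r ^^ i) xs \<in> vec_chains r A m"
proof (induction i)
  case 0
  with assms show ?case by simp
next
  case (Suc i)
  from vec_chains_rotate[OF Suc] show ?case by (simp add: o_def)
qed

text \<open>For \<open>b\<close> outside \<open>A\<close>, filling \<open>b\<close> strictly
  enlarges a vector and preserves strict extension. So every list on which \<open>cone\<close>
  evaluates \<open>F\<close> is a chain above \<open>y\<close> with one entry more than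
  \<open>xs\<close>.\<close>

lemma cone_cong:
  assumes "sorted_wrt (\<sqsubset>) (y # xs)" and "set (y # xs) \<subseteq> partial_vecs r A"
    and "b \<notin> A" and "1 \<le> r"
    and "\<And>zs. length zs = Suc (length xs) \<Longrightarrow> sorted_wrt (\<sqsubset>) (y # zs) \<Longrightarrow>
      set zs \<subseteq> partial_vecs r (insert b A) \<Longrightarrow> F zs = G zs"
  shows "cone (\<lambda>X. X(b := 1)) F y xs = cone (\<lambda>X. X(b := 1)) G y xs"
  using assms
proof (induction xs arbitrary: F G y)
  case Nil
  have "y \<sqsubset> y(b := 1)" "y(b := 1) \<in> partial_vecs r (insert b A)"
    using Nil by (auto simp: extended_by_def partial_vecs_def fun_eq_iff)
  then show ?case
    unfolding cone.simps by (intro Nil.prems(5)) auto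
next
  case (Cons x xs)
  have b0: "X b = 0" if "X \<in> partial_vecs r A" for X
    using that \<open>b \<notin> A\<close> by (auto simp: partial_vecs_def)
  have mono: "X(b := 1) \<sqsubset> Y(b := 1)"
    if XY: "X \<sqsubset> Y" "X \<in> partial_vecs r A" "Y \<in> partial_vecs r A" for X Y
  proof -
    obtain i where "X i \<noteq> Y i"
      using XY(1) by (auto simp: extended_by_def fun_eq_iff)
    moreover from this have "i \<noteq> b"
      using b0[OF XY(2)] b0[OF XY(3)] by auto
    ultimately have "X(b := 1) \<noteq> Y(b := 1)"
      by (metis fun_upd_other)
    with XY(1) show ?thesis
      by (auto simp: extended_by_def)
  qed
  have self: "X \<sqsubset> X(b := 1)" if "X \<in> partial_vecs r A" for X
    using b0[OF that] by (auto simp: extended_by_def fun_eq_iff)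
  have mem: "X(b := 1) \<in> partial_vecs r (insert b A)" if "X \<in> partial_vecs r A" for X
    using that \<open>1 \<le> r\<close> by (auto simp: partial_vecs_def)
  let ?m = "map (\<lambda>X. X(b := 1)) (y # x # xs)"
  have "sorted_wrt (\<sqsubset>) ?m"
    unfolding sorted_wrt_map
    by (rule sorted_wrt_mono_rel[OF _ Cons.prems(1)]) (use mono Cons.prems(2) in blast)
  moreover have "y \<sqsubset> z" if "z \<in> set ?m" for z
  proof -
    from that obtain X where X: "X \<in> set (y # x # xs)" "z = X(b := 1)" by auto
    then have "X = y \<or> y \<sqsubset> X"
      using Cons.prems(1) by auto
    then show ?thesis
      using self[of X] X Cons.prems(2) extended_by_trans by blast
  qed
  ultimately have "sorted_wrt (\<sqsubset>) (y # ?m)"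
    by (simp only: sorted_wrt.simps) blast
  moreover have "set ?m \<subseteq> partial_vecs r (insert b A)"
    using Cons.prems(2) mem by auto
  ultimately have "F ?m = G ?m"
    by (intro Cons.prems(5)) auto
  moreover have "cone (\<lambda>X. X(b := 1)) (\<lambda>zs. F (x # zs)) x xs
      = cone (\<lambda>X. X(b := 1)) (\<lambda>zs. G (x # zs)) x xs"
  proof (rule Cons.IH)
    fix zs
    assume zs: "length zs = Suc (length xs)" "sorted_wrt (\<sqsubset>) (x # zs)"
      "set zs \<subseteq> partial_vecs r (insert b A)"
    have yx: "y \<sqsubset> x"
      using Cons.prems(1) by simp
    moreover have "y \<sqsubset> z" if "z \<in> set zs" for z
      using that zs(2) yx extended_by_trans by (metis sorted_wrt.simps(2))
    ultimately have "sorted_wrt (\<sqsubset>) (y # x # zs)"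
      using zs(2) by simp
    moreover have "x \<in> partial_vecs r (insert b A)"
      using Cons.prems(2) by (auto simp: partial_vecs_def)
    ultimately show "F (x # zs) = G (x # zs)"
      using zs by (intro Cons.prems(5)) auto
  qed (use Cons.prems in auto)
  ultimately show ?case
    by (simp only: cone.simps list.map)
qed

abbreviation evaluate_vec ::
    "nat \<Rightarrow> (nat \<Rightarrow> 'i) \<Rightarrow> nat \<Rightarrow> (('i \<Rightarrow> nat) list \<Rightarrow> 'g :: ab_group_add) \<Rightarrow> 'g" where
  "evaluate_vec r e \<equiv> evaluate (rotate_vec r) r (\<lambda>k X. X(e k := 1)) (\<lambda>_. 0)"

text \<open>Each cone adds one vector and one coordinate, and rotations map chains to chains, so
  only values on \<open>vec_chains\<close> enter. Hence a nonzero value exhibits an actual chain of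
  vectors.\<close>

lemma evaluate_vec_cong:
  assumes "inj_on e {..k}" and "1 \<le> r"
    and "\<And>xs. xs \<in> vec_chains r (e ` {..k}) (Suc k) \<Longrightarrow> F xs = G xs"
  shows "evaluate_vec r e k F = evaluate_vec r e k G"
  using assms
proof (induction k arbitrary: F G)
  case 0
  have "[(\<lambda>_. 0)(e 0 := 1)] \<in> vec_chains r (e ` {..0}) (Suc 0)"
    using \<open>1 \<le> r\<close> by (auto simp: vec_chains_def partial_vecs_def fun_eq_iff)
  then show ?case
    unfolding evaluate.simps by (rule 0)
next
  case (Suc k)
  let ?c = "\<lambda>H. cone (\<lambda>X. X(e (Suc k) := 1)) H (\<lambda>_. 0)"
  have b: "e (Suc k) \<notin> e ` {..k}"
    using inj_onD[OF Suc.prems(1)] by fastforce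
  have c: "?c F xs = ?c G xs" if "xs \<in> vec_chains r (e ` {..k}) (Suc k)" for xs
  proof (rule cone_cong[OF _ _ b \<open>1 \<le> r\<close>])
    show "sorted_wrt (\<sqsubset>) ((\<lambda>_. 0) # xs)" "set ((\<lambda>_. 0) # xs) \<subseteq> partial_vecs r (e ` {..k})"
      using that by (auto simp: vec_chains_def partial_vecs_def)
    fix zs :: "('a \<Rightarrow> nat) list"
    assume "length zs = Suc (length xs)" "sorted_wrt (\<sqsubset>) ((\<lambda>_. 0) # zs)"
      "set zs \<subseteq> partial_vecs r (insert (e (Suc k)) (e ` {..k}))"
    with that show "F zs = G zs"
      by (intro Suc.prems(3)) (auto simp: vec_chains_def atMost_Suc)
  qed
  have "evaluate_vec r e k (twist (rotate_vec r) r k (?c F))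
      = evaluate_vec r e k (twist (rotate_vec r) r k (?c G))"
  proof (rule Suc.IH)
    fix xs :: "('a \<Rightarrow> nat) list"
    assume xs: "xs \<in> vec_chains r (e ` {..k}) (Suc k)"
    show "twist (rotate_vec r) r k (?c F) xs = twist (rotate_vec r) r k (?c G) xs"
      unfolding twist_def
      by (simp only: c[OF xs] c[OF vec_chains_rotate[OF xs]] c[OF vec_chains_funpow_rotate[OF xs]])
  qed (use Suc.prems in \<open>auto simp: inj_on_def\<close>)
  then show ?case
    by (simp only: evaluate.simps)
qed

text \<open>A \<open>\<int>\<^sub>r\<close>-version of Ky Fan's theorem. Starting from the constant \<open>\<zeta>\<close> of order \<open>r\<close>, alternately
  untwisting and taking coboundaries gives cocycles in every degree that all evaluate to \<open>\<zeta>\<close>.\<close>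

theorem equivariant_labelling_chain:
  fixes s :: "('i \<Rightarrow> nat) \<Rightarrow> int"
  assumes r: "2 \<le> r" and A: "finite A" "A \<noteq> {}"
    and s: "\<And>X. X \<in> partial_vecs r A \<Longrightarrow> X \<noteq> (\<lambda>_. 0) \<Longrightarrow>
      s (rotate_vec r X) mod int r = (s X + 1) mod int r"
  obtains xs where "xs \<in> vec_chains r A (card A)" "distinct_adj (map s xs)"
proof -
  obtain e where e: "bij_betw e {0..<card A} A"
    using ex_bij_betw_nat_finite[OF A(1)] by blast
  obtain \<zeta> :: rat_mod_int where \<zeta>: "\<zeta> \<noteq> 0" "(\<Sum>i<r. \<zeta>) = 0"
    using ex_torsion_rat_mod_int[OF r] .
  have inj: "inj_on e {..k}" and sub: "e ` {..k} \<subseteq> A" if "k < card A" for k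
    using e that by (auto simp: bij_betw_def inj_on_def)
  \<comment> \<open>The labelling turns rotation into adding \<open>1\<close> modulo
    \<open>r\<close>, but only on nonzero vectors of \<open>partial_vecs r A\<close>;
    \<open>evaluate_vec_cong\<close> confines the comparison to these.\<close>
  have pull: "evaluate_vec r e k (twist (rotate_vec r) r k (\<lambda>xs. u (map s xs)))
      = evaluate_vec r e k (\<lambda>xs. twist (\<lambda>a. a + 1) r k u (map s xs))"
    if "k < card A" and u: "cyclic_cochain r u" for k and u :: "int list \<Rightarrow> rat_mod_int"
  proof (rule evaluate_vec_cong)
    fix xs assume xs: "xs \<in> vec_chains r (e ` {..k}) (Suc k)"
    have X: "X \<in> partial_vecs r A" "X \<noteq> (\<lambda>_. 0)" if "X \<in> set xs" for X
      using that xs partial_vecs_mono[OF sub[OF \<open>k < card A\<close>]] by (auto simp: vec_chains_def)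
    have si: "s ((rotate_vec r ^^ i) X) mod int r = (s X + int i) mod int r
        \<and> (rotate_vec r ^^ i) X \<in> partial_vecs r A \<and> (rotate_vec r ^^ i) X \<noteq> (\<lambda>_. 0)"
      if "X \<in> set xs" for X i
    proof (induction i)
      case 0
      with X[OF that] show ?case by simp
    next
      case (Suc i)
      let ?Y = "(rotate_vec r ^^ i) X"
      have eq: "(rotate_vec r ^^ Suc i) X = rotate_vec r ?Y"
        by (simp only: funpow.simps o_apply)
      have "s (rotate_vec r ?Y) mod int r = (s ?Y mod int r + 1) mod int r"
        using s[of ?Y] Suc by (simp add: mod_simps)
      also have "\<dots> = (s X + int (Suc i)) mod int r"
        by (simp only: conjunct1[OF Suc]) (simp add: mod_simps add_ac)
      finally show ?case
        using Suc unfolding eq rotate_partial_vecs rotate_eq_zero by blast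
    qed
    have "u (map (\<lambda>X. s ((rotate_vec r ^^ i) X)) xs) = u (map (\<lambda>X. s X + int i) xs)" for i
    proof -
      have "map (\<lambda>a. a mod int r) (map (\<lambda>X. s ((rotate_vec r ^^ i) X)) xs)
          = map (\<lambda>a. a mod int r) (map (\<lambda>X. s X + int i) xs)"
        using si by simp
      then show ?thesis
        using u unfolding cyclic_cochain_def by metis
    qed
    note ui = this this[of 1]
    show "twist (rotate_vec r) r k (\<lambda>xs. u (map s xs)) xs
        = twist (\<lambda>a. a + 1) r k u (map s xs)"
      using ui by (simp add: twist_def funpow_plus_1 o_def)
  qed (use inj[OF \<open>k < card A\<close>] r in auto)
  have "\<exists>f. cyclic_cochain r f \<and> coboundary f = (\<lambda>_. 0) \<and>
      twist (\<lambda>a. a + 1) r (Suc k) f = (\<lambda>_. 0) \<and>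
      evaluate_vec r e k (\<lambda>xs. f (map s xs)) = \<zeta>" if "k < card A" for k
    using that
  proof (induction k)
    case 0
    \<comment> \<open>The constant on singletons is a cocycle because its values at the two ends of
      an edge cancel; its norm is \<open>r\<close> times \<zeta>, which is zero.\<close>
    define f where "f xs = (if length xs = 1 then \<zeta> else 0)" for xs :: "int list"
    have "cyclic_cochain r f"
      by (auto simp: f_def cyclic_cochain_def length_Suc_conv)
    moreover have "coboundary f = (\<lambda>_. 0)"
    proof
      show "coboundary f xs = 0" for xs
        by (cases xs; cases "tl xs"; cases "tl (tl xs)") (auto simp: f_def)
    qed
    moreover have "twist (\<lambda>a. a + 1) r (Suc 0) f = (\<lambda>_. 0)"
      using \<zeta> by (auto simp: twist_def f_def fun_eq_iff)
    moreover have "evaluate_vec r e 0 (\<lambda>xs. f (map s xs)) = \<zeta>"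
      by (simp add: f_def)
    ultimately show ?case by blast
  next
    case (Suc k)
    from Suc.IH[OF Suc_lessD[OF Suc.prems]]
    obtain f where f: "cyclic_cochain r f" "coboundary f = (\<lambda>_. 0)"
        "twist (\<lambda>a. a + 1) r (Suc k) f = (\<lambda>_. 0)"
        "evaluate_vec r e k (\<lambda>xs. f (map s xs)) = \<zeta>"
      by blast
    \<comment> \<open>Untwisting keeps the degree; the coboundary of \<open>u\<close> is the cocycle
      one degree higher.\<close>
    obtain u where u: "cyclic_cochain r u" "twist (\<lambda>a. a + 1) r k u = f"
      using cyclic_cochain_untwist[OF _ f(1,3)] r by auto
    \<comment> \<open>\<open>k\<close> and \<open>Suc (Suc k)\<close> have the same parity, hence
      the same twist.\<close>
    have "twist (\<lambda>a. a + 1) r (Suc (Suc k)) (coboundary u)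
        = coboundary (twist (\<lambda>a. a + 1) r k u)"
      by (simp add: fun_eq_iff coboundary_twist) (simp add: twist_def)
    then have "twist (\<lambda>a. a + 1) r (Suc (Suc k)) (coboundary u) = (\<lambda>_. 0)"
      by (simp add: u f)
    moreover have "evaluate_vec r e (Suc k) (\<lambda>xs. coboundary u (map s xs)) = \<zeta>"
    proof -
      have "evaluate_vec r e (Suc k) (coboundary (\<lambda>xs. u (map s xs)))
          = evaluate_vec r e k (twist (rotate_vec r) r k (\<lambda>xs. u (map s xs)))"
        by (rule evaluate_coboundary[OF funpow_rotate_vec])
      also have "\<dots> = \<zeta>"
        unfolding pull[OF Suc_lessD[OF Suc.prems] u(1)] u(2) by (rule f(4))
      finally show ?thesis
        by (simp only: coboundary_map)
    qed
    moreover have "coboundary (coboundary u) = (\<lambda>_. 0)"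
      by (simp add: fun_eq_iff)
    ultimately show ?case
      using cyclic_cochain_coboundary[OF u(1)] by blast
  qed
  moreover define k where "k = card A - 1"
  have k: "k < card A" "Suc k = card A"
    using A by (auto simp: k_def card_gt_0_iff)
  ultimately obtain f where f: "cyclic_cochain r f"
      "evaluate_vec r e k (\<lambda>xs. f (map s xs)) = \<zeta>"
    by blast
  have "\<exists>xs \<in> vec_chains r (e ` {..k}) (Suc k). f (map s xs) \<noteq> 0"
  proof (rule ccontr)
    assume "\<not> ?thesis"
    then have "evaluate_vec r e k (\<lambda>xs. f (map s xs)) = evaluate_vec r e k (\<lambda>_. 0)"
      by (intro evaluate_vec_cong inj k) (use r in auto)
    with f \<zeta> show False by (simp add: evaluate_zero)
  qed
  then obtain xs where xs: "xs \<in> vec_chains r (e ` {..k}) (Suc k)" "f (map s xs) \<noteq> 0"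
    by blast
  show ?thesis
  proof (rule that)
    show "xs \<in> vec_chains r A (card A)"
      using xs(1) partial_vecs_mono[OF sub[OF k(1)]] k(2) by (auto simp: vec_chains_def)
    show "distinct_adj (map s xs)"
      using xs(2) f(1) by (auto simp: cyclic_cochain_def)
  qed
qed

text \<open>Neighbouring labels differ along the chain of
  \<open>equivariant_labelling_chain\<close>, so by \<open>mono\<close> the heights strictly
  increase. They start at \<open>1\<close> or more, and the chain has \<open>card A\<close>
  members.\<close>

theorem equivariant_height_bound:
  fixes s :: "('i \<Rightarrow> nat) \<Rightarrow> int" and ht :: "('i \<Rightarrow> nat) \<Rightarrow> nat"
  assumes r: "2 \<le> r" and A: "finite A" "A \<noteq> {}"
    and s: "\<And>X. X \<in> partial_vecs r A \<Longrightarrow> X \<noteq> (\<lambda>_. 0) \<Longrightarrow>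
      s (rotate_vec r X) mod int r = (s X + 1) mod int r"
    and pos: "\<And>X. X \<in> partial_vecs r A \<Longrightarrow> X \<noteq> (\<lambda>_. 0) \<Longrightarrow> 0 < ht X"
    and mono: "\<And>X Y. X \<in> partial_vecs r A \<Longrightarrow> Y \<in> partial_vecs r A \<Longrightarrow> X \<noteq> (\<lambda>_. 0) \<Longrightarrow>
      X \<sqsubset> Y \<Longrightarrow> ht X \<le> ht Y \<and> (ht X = ht Y \<longrightarrow> s X = s Y)"
  obtains X where "X \<in> partial_vecs r A" "X \<noteq> (\<lambda>_. 0)" "card A \<le> ht X"
proof -
  obtain xs where xs: "xs \<in> vec_chains r A (card A)" "distinct_adj (map s xs)"
    using equivariant_labelling_chain[where s = s, OF r A s] .
  have len: "length xs = card A" and sorted: "sorted_wrt (\<sqsubset>) xs"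
    using xs(1) by (auto simp: vec_chains_def)
  have mem: "xs ! i \<in> partial_vecs r A" "xs ! i \<noteq> (\<lambda>_. 0)" if "i < card A" for i
    using xs(1) that by (auto simp: vec_chains_def)
  have "i < ht (xs ! i)" if "i < card A" for i
    using that
  proof (induction i)
    case 0
    then show ?case using pos mem by blast
  next
    case (Suc i)
    have "s (xs ! i) \<noteq> s (xs ! Suc i)"
      using xs(2) Suc.prems len by (simp add: distinct_adj_conv_nth)
    moreover have "xs ! i \<sqsubset> xs ! Suc i"
      using sorted_wrt_nth_less[OF sorted, of i "Suc i"] Suc.prems len by simp
    ultimately have "ht (xs ! i) < ht (xs ! Suc i)"
      using mono[of "xs ! i" "xs ! Suc i"] mem[of i] mem[of "Suc i"] Suc.prems
      by (auto simp: le_less)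
    with Suc show ?case by simp
  qed
  from this[of "card A - 1"] have "card A \<le> ht (xs ! (card A - 1))" "card A - 1 < card A"
    using A by (auto simp: card_gt_0_iff)
  with that mem show ?thesis by blast
qed

section \<open>Alternating vectors avoiding set families\<close>

definition supp :: "('i \<Rightarrow> nat) \<Rightarrow> 'i set" where
  "supp X = {j. X j \<noteq> 0}"

lemma supp_rotate [simp]: "supp (rotate_vec r X) = supp X"
  by (simp add: supp_def)

lemma supp_subset: "X \<in> partial_vecs r V \<Longrightarrow> supp X \<subseteq> V"
  by (auto simp: supp_def partial_vecs_def)

lemma supp_eq_empty: "supp X = {} \<longleftrightarrow> X = (\<lambda>_. 0)"
  by (auto simp: supp_def)

lemma supp_extended: "X \<sqsubset> Y \<Longrightarrow> supp X \<subseteq> supp Y"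
  by (auto simp: supp_def extended_by_def)

text \<open>Index sets replace subsequences, so that passing to an extension of \<open>X\<close> and
  prepending an index become set operations.\<close>

definition alternating_on :: "(nat \<Rightarrow> nat) \<Rightarrow> nat set \<Rightarrow> bool" where
  "alternating_on X A \<longleftrightarrow>
     (\<forall>a \<in> A. \<forall>b \<in> A. a < b \<longrightarrow> (\<forall>c \<in> A. \<not> (a < c \<and> c < b)) \<longrightarrow> X a \<noteq> X b)"

lemma alternating_on_cong:
  "(\<And>a. a \<in> A \<Longrightarrow> X a = Y a) \<Longrightarrow> alternating_on X A \<longleftrightarrow> alternating_on Y A"
  by (auto simp: alternating_on_def)

lemma alternating_on_extended:
  assumes "X \<sqsubset> Y" and "A \<subseteq> supp X" and "alternating_on X A"
  shows "alternating_on Y A"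
proof -
  have "X a = Y a" if "a \<in> A" for a
    using that assms(1,2) by (auto simp: extended_by_def supp_def subset_iff)
  with assms(3) show ?thesis
    using alternating_on_cong by blast
qed

lemma alternating_on_insert:
  assumes "alternating_on X A" and "finite A" "A \<noteq> {}" and "j < Min A" and "X j \<noteq> X (Min A)"
  shows "alternating_on X (insert j A)"
  unfolding alternating_on_def
proof (intro ballI impI)
  fix a b
  assume ab: "a \<in> insert j A" "b \<in> insert j A" "a < b"
    and between: "\<forall>c \<in> insert j A. \<not> (a < c \<and> c < b)"
  have j: "j < c" if "c \<in> A" for c
    using that assms by (meson Min_le less_le_trans)
  with ab have b: "b \<in> A"
    by (metis insertE less_asym)
  show "X a \<noteq> X b"
  proof (cases "a \<in> A")
    case True
    with b ab between assms(1) show ?thesis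
      by (auto simp: alternating_on_def)
  next
    case False
    with ab have "a = j" by simp
    have "Min A \<in> A" "Min A \<le> b"
      using assms b by auto
    with between \<open>a = j\<close> assms(4) have "b = Min A"
      by (metis insertI2 le_neq_implies_less)
    with \<open>a = j\<close> assms(5) show ?thesis by simp
  qed
qed

definition max_alt :: "(nat \<Rightarrow> nat) \<Rightarrow> nat" where
  "max_alt X = Max (card ` {A. A \<subseteq> supp X \<and> alternating_on X A})"

lemma max_alt_ge:
  assumes "finite (supp X)" and "A \<subseteq> supp X" and "alternating_on X A"
  shows "card A \<le> max_alt X"
  unfolding max_alt_def using assms by (intro Max_ge) auto

lemma max_alt_obtain:
  assumes "finite (supp X)"
  obtains A where "A \<subseteq> supp X" "alternating_on X A" "card A = max_alt X"
proof -
  let ?S = "card ` {A. A \<subseteq> supp X \<and> alternating_on X A}"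
  have "{} \<in> {A. A \<subseteq> supp X \<and> alternating_on X A}"
    by (simp add: alternating_on_def)
  then have "?S \<noteq> {}" by blast
  moreover have "finite ?S"
    using assms by simp
  ultimately have "max_alt X \<in> ?S"
    unfolding max_alt_def by (rule Max_in[rotated])
  with that show ?thesis by auto
qed

lemma max_alt_pos:
  assumes "finite (supp X)" and "X \<noteq> (\<lambda>_. 0)"
  shows "0 < max_alt X"
proof -
  obtain j where "j \<in> supp X"
    using assms(2) supp_eq_empty by blast
  then have "card {j} \<le> max_alt X"
    by (intro max_alt_ge assms) (auto simp: alternating_on_def)
  then show ?thesis by simp
qed

lemma max_alt_mono:
  assumes "X \<sqsubset> Y" and "finite (supp Y)"
  shows "max_alt X \<le> max_alt Y"
proof -
  have sub: "supp X \<subseteq> supp Y"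
    by (rule supp_extended[OF assms(1)])
  then obtain A where A: "A \<subseteq> supp X" "alternating_on X A" "card A = max_alt X"
    using max_alt_obtain[of X] assms(2) finite_subset by blast
  have "alternating_on Y A"
    using assms(1) A(1,2) by (rule alternating_on_extended)
  with A sub assms(2) show ?thesis
    by (metis max_alt_ge subset_trans)
qed

text \<open>A longest alternating set of \<open>X\<close> begins with the symbol of the first
  nonzero entry, since otherwise that entry could be prepended. If \<open>Y\<close> began with
  another symbol, its first index would precede all of \<open>supp X\<close> and could be prepended,
  making \<open>max_alt Y\<close> larger.\<close>

lemma max_alt_eq_imp_first_eq:
  assumes "X \<sqsubset> Y" and fin: "finite (supp Y)" and "X \<noteq> (\<lambda>_. 0)" and eq: "max_alt X = max_alt Y"
  shows "X (Min (supp X)) = Y (Min (supp Y))"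
proof (rule ccontr)
  assume ne: "X (Min (supp X)) \<noteq> Y (Min (supp Y))"
  have sub: "supp X \<subseteq> supp Y"
    by (rule supp_extended[OF assms(1)])
  have finX: "finite (supp X)"
    using sub fin finite_subset by blast
  have neX: "supp X \<noteq> {}"
    using assms(3) by (simp add: supp_eq_empty)
  have YX: "Y i = X i" if "i \<in> supp X" for i
    using that assms(1) by (auto simp: supp_def extended_by_def)
  let ?x = "Min (supp X)" and ?y = "Min (supp Y)"
  have x: "?x \<in> supp X" and y: "?y \<in> supp Y"
    using finX neX fin sub by (auto intro!: Min_in)
  have "?y \<le> ?x"
    using x sub fin by (simp add: subsetD)
  moreover have "?y \<noteq> ?x"
    using ne YX[OF x] by auto
  ultimately have yx: "?y < ?x" by simp
  obtain A where A: "A \<subseteq> supp X" "alternating_on X A" "card A = max_alt X"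
    using max_alt_obtain[OF finX] .
  have finA: "finite A"
    using A(1) finX finite_subset by blast
  have "A \<noteq> {}"
    using A(3) max_alt_pos[OF finX assms(3)] by auto
  then have mA: "Min A \<in> A"
    using finA by simp
  then have xA: "?x \<le> Min A"
    using A(1) finX by auto
  have "X (Min A) = X ?x"
  proof (rule ccontr)
    assume ne': "X (Min A) \<noteq> X ?x"
    then have lt: "?x < Min A"
      using xA by (metis le_neq_implies_less)
    then have "?x \<notin> A"
      using finA Min_le not_le by blast
    have "alternating_on X (insert ?x A)"
      using A finA \<open>A \<noteq> {}\<close> lt ne' by (intro alternating_on_insert) auto
    then have "card (insert ?x A) \<le> max_alt X"
      using finX x A(1) by (intro max_alt_ge) auto
    with \<open>?x \<notin> A\<close> finA A(3) show False by simp
  qed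
  with ne have "Y ?y \<noteq> Y (Min A)"
    using YX mA A(1) by auto
  moreover have "alternating_on Y A"
    using assms(1) A(1,2) by (rule alternating_on_extended)
  ultimately have "alternating_on Y (insert ?y A)"
    using finA \<open>A \<noteq> {}\<close> yx xA by (intro alternating_on_insert) auto
  then have "card (insert ?y A) \<le> max_alt Y"
    using fin y A(1) sub by (intro max_alt_ge) auto
  moreover have "?y \<notin> A"
    using finA yx xA by (meson Min_le not_le less_le_trans)
  ultimately show False
    using finA A(3) eq by simp
qed

section \<open>Set families without \<open>r\<close> disjoint members\<close>

definition packs :: "nat \<Rightarrow> 'a set set \<Rightarrow> 'a set \<Rightarrow> bool" where
  "packs r F V \<longleftrightarrow> (\<exists>W. (\<forall>i \<in> {1..r}. W i \<in> F \<and> W i \<subseteq> V) \<and> disjoint_family_on W {1..r})"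

definition sparse :: "nat \<Rightarrow> 'a set set \<Rightarrow> ('a \<Rightarrow> nat) \<Rightarrow> bool" where
  "sparse r F X \<longleftrightarrow> (\<forall>i \<in> {1..r}. \<forall>B \<in> F. \<not> B \<subseteq> {j. X j = i})"

text \<open>The quantification over \<open>V\<close> and \<open>F\<close> serves the product step,
  which uses derived families and the classes of a vector.\<close>

definition alternation_bound :: "nat \<Rightarrow> bool" where
  "alternation_bound r \<longleftrightarrow> (\<forall>V C F. finite V \<longrightarrow> (\<forall>k<C. {} \<notin> F k \<and> \<not> packs r (F k) V) \<longrightarrow>
     (\<exists>X \<in> partial_vecs r V. alternating_on X (supp X) \<and> (\<forall>k<C. sparse r (F k) X) \<and>
        card V \<le> card (supp X) + (r - 1) * C))"

lemma alternation_boundE: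
  assumes "alternation_bound r" and "finite V"
    and "\<And>k. k < C \<Longrightarrow> {} \<notin> F k" and "\<And>k. k < C \<Longrightarrow> \<not> packs r (F k) V"
  obtains X where "X \<in> partial_vecs r V" "alternating_on X (supp X)"
    "\<And>k. k < C \<Longrightarrow> sparse r (F k) X" "card V \<le> card (supp X) + (r - 1) * C"
proof -
  have "\<exists>X \<in> partial_vecs r V. alternating_on X (supp X) \<and> (\<forall>k<C. sparse r (F k) X) \<and>
      card V \<le> card (supp X) + (r - 1) * C"
    using spec[OF spec[OF spec[OF assms(1)[unfolded alternation_bound_def], of V], of C], of F]
      assms(2-) by blast
  with that show ?thesis by blast
qed

section \<open>The prime case\<close>

lemma ex_inverse_mod_prime:
  fixes p :: nat
  assumes "prime p"
  shows "\<exists>a :: nat \<Rightarrow> int. \<forall>m. 0 < m \<longrightarrow> m < p \<longrightarrow> [a m * int m = 1] (mod int p)"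
proof -
  have "\<exists>x. [x * int m = 1] (mod int p)" if "0 < m" "m < p" for m
  proof -
    have "coprime m p"
      using that assms by (metis coprime_commute nat_dvd_not_less prime_imp_coprime)
    then have "coprime (int m) (int p)" by simp
    then show ?thesis
      using cong_solve_coprime_int by (metis mult.commute)
  qed
  then show ?thesis by metis
qed

lemma alternation_bound_prime:
  assumes p: "prime p"
  shows "alternation_bound p"
  unfolding alternation_bound_def
proof (intro allI impI, rule ccontr)
  fix V :: "nat set" and C :: nat and F :: "nat \<Rightarrow> nat set set"
  assume V: "finite V" and F: "\<forall>k<C. {} \<notin> F k \<and> \<not> packs p (F k) V"
    and "\<not> (\<exists>X \<in> partial_vecs p V. alternating_on X (supp X) \<and> (\<forall>k<C. sparse p (F k) X) \<and>
        card V \<le> card (supp X) + (p - 1) * C)"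
  then have neg: "card (supp X) + (p - 1) * C < card V"
    if "X \<in> partial_vecs p V" "alternating_on X (supp X)" "\<forall>k<C. sparse p (F k) X" for X
    using that by (meson not_le)
  have p2: "2 \<le> p"
    using p by (rule prime_ge_2_nat)
  \<comment> \<open>By the assumed failure, vectors avoiding all \<open>F k\<close> have alternation
    number at most \<open>c\<close>. Above \<open>c\<close> each of the \<open>C\<close> colours
    gets a block of \<open>p - 1\<close> heights; the last block ends at
    \<open>card V - 1\<close>.\<close>
  define c where "c = card V - 1 - (p - 1) * C"
  \<comment> \<open>The zero vector is sparse as no \<open>F k\<close> contains the empty set.
    Applying \<open>neg\<close> to it shows that the subtraction in \<open>c\<close> does not
    truncate.\<close>
  have "sparse p (F k) (\<lambda>_. 0)" if "k < C" for k
  proof -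
    have "B \<noteq> {}" if "B \<in> F k" for B
      using that \<open>k < C\<close> F by auto
    then show ?thesis by (auto simp: sparse_def)
  qed
  then have "(p - 1) * C < card V"
    using neg[of "\<lambda>_. 0"] by (auto simp: supp_def partial_vecs_def alternating_on_def)
  then have c: "c + (p - 1) * C + 1 = card V" and "V \<noteq> {}"
    by (auto simp: c_def)
  have fin: "finite (supp X)" if "X \<in> partial_vecs p V" for X
    by (rule finite_subset[OF supp_subset[OF that] V])
  define K where "K X = {k. k < C \<and> \<not> sparse p (F k) X}" for X
  define S where "S X = {i \<in> {1..p}. \<exists>B \<in> F (Max (K X)). B \<subseteq> {j. X j = i}}" for X
  obtain a :: "nat \<Rightarrow> int" where a: "\<forall>m. 0 < m \<longrightarrow> m < p \<longrightarrow> [a m * int m = 1] (mod int p)"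
    using ex_inverse_mod_prime[OF p] by blast
  \<comment> \<open>Rotation adds \<open>card (S X)\<close> to the sum over \<open>S X\<close>; the factor \<open>a\<close> rescales this to \<open>1\<close>.\<close>
  define s where "s X = (if K X = {} then int (X (Min (supp X)))
    else a (card (S X)) * (\<Sum>i \<in> S X. int i))" for X
  define ht where "ht X = (if K X = {} then max_alt X
    else c + Max (K X) * (p - 1) + card (S X))" for X
  have K_iff: "k \<in> K X \<longleftrightarrow> k < C \<and> \<not> sparse p (F k) X" for k X
    by (simp add: K_def)
  have finK: "finite (K X)" for X
    by (simp add: K_def)
  have MaxK: "Max (K X) \<in> K X" if "K X \<noteq> {}" for X
    using that finK by simp
  have finS: "finite (S X)" for X
    by (simp add: S_def)
  have S_ne: "S X \<noteq> {}" if "K X \<noteq> {}" for X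
  proof -
    have "\<not> sparse p (F (Max (K X))) X"
      using MaxK[OF that] unfolding K_iff by blast
    then show ?thesis
      unfolding S_def sparse_def by blast
  qed
  have S_card: "0 < card (S X)" "card (S X) \<le> p - 1"
    if KX: "K X \<noteq> {}" and X: "X \<in> partial_vecs p V" for X
  proof -
    show "0 < card (S X)"
      using S_ne[OF KX] finS by (simp add: card_gt_0_iff)
    \<comment> \<open>If every class contained a member of the family, these \<open>p\<close>
      members would be disjoint and form a packing.\<close>
    have "S X \<noteq> {1..p}"
    proof
      assume eq: "S X = {1..p}"
      have "\<exists>B. B \<in> F (Max (K X)) \<and> B \<subseteq> {j. X j = i}" if "i \<in> {1..p}" for i
        using that unfolding eq[symmetric] by (auto simp: S_def)
      then obtain W where W: "\<And>i. i \<in> {1..p} \<Longrightarrow> W i \<in> F (Max (K X)) \<and> W i \<subseteq> {j. X j = i}"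
        by metis
      have "packs p (F (Max (K X))) V"
        unfolding packs_def
      proof (intro exI[of _ W] conjI ballI)
        show "W i \<in> F (Max (K X))" "W i \<subseteq> V" if "i \<in> {1..p}" for i
          using W[OF that] that X by (auto simp: partial_vecs_def)
        show "disjoint_family_on W {1..p}"
          unfolding disjoint_family_on_def
        proof (intro ballI impI)
          show "W i \<inter> W j = {}" if "i \<in> {1..p}" "j \<in> {1..p}" "i \<noteq> j" for i j
            using W[OF that(1)] W[OF that(2)] that(3) by blast
        qed
      qed
      moreover have "Max (K X) < C"
        using MaxK[OF KX] by (simp add: K_def)
      ultimately show False
        using F by blast
    qed
    then have "S X \<subset> {1..p}"
      by (auto simp: S_def)
    then have "card (S X) < card {1..p}"
      by (rule psubset_card_mono[rotated]) simp
    then show "card (S X) \<le> p - 1" by simp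
  qed
  have sparse_le: "max_alt X \<le> c" if KX: "K X = {}" and X: "X \<in> partial_vecs p V" for X
  proof -
    obtain A where A: "A \<subseteq> supp X" "alternating_on X A" "card A = max_alt X"
      using max_alt_obtain[OF fin[OF X]] .
    \<comment> \<open>Deleting the entries outside a longest alternating set keeps the vector sparse
      and makes its whole support alternating, so \<open>neg\<close> applies.\<close>
    define Z where "Z j = (if j \<in> A then X j else 0)" for j
    have supp_Z: "supp Z = A"
      using A(1) by (auto simp: Z_def supp_def)
    have "sparse p (F k) Z" if "k < C" for k
    proof -
      have "{j. Z j = i} \<subseteq> {j. X j = i}" if "i \<in> {1..p}" for i
        using that by (auto simp: Z_def)
      moreover have "sparse p (F k) X"
        using that KX by (auto simp: K_def)
      ultimately show ?thesis
        unfolding sparse_def by (meson subset_trans)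
    qed
    moreover have "alternating_on Z A"
      using A(2) by (rule iffD1[OF alternating_on_cong, rotated]) (simp add: Z_def)
    moreover have "Z \<in> partial_vecs p V"
      using X by (auto simp: Z_def partial_vecs_def)
    ultimately have "card A + (p - 1) * C < card V"
      using neg[of Z] by (simp add: supp_Z)
    with A(3) c show ?thesis by simp
  qed
  have K_mono: "K X \<subseteq> K Y" if "X \<sqsubset> Y" for X Y
  proof -
    have "{j. X j = i} \<subseteq> {j. Y j = i}" if "i \<in> {1..p}" for i
      using that \<open>X \<sqsubset> Y\<close> by (auto simp: extended_by_def)
    then show ?thesis
      unfolding K_def sparse_def by (smt (verit) Collect_mono subset_trans)
  qed
  have S_mono: "S X \<subseteq> S Y" if "X \<sqsubset> Y" "Max (K X) = Max (K Y)" for X Y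
  proof -
    have "{j. X j = i} \<subseteq> {j. Y j = i}" if "i \<in> {1..p}" for i
      using that \<open>X \<sqsubset> Y\<close> by (auto simp: extended_by_def)
    then show ?thesis
      unfolding S_def that(2) by (smt (verit) Collect_mono subset_trans)
  qed
  \<comment> \<open>Rotation permutes the classes, so it keeps the hit colours and rotates
    \<open>S\<close>.\<close>
  have rot: "{j. rotate_vec p X j = rotate_symbol p i} = {j. X j = i}" for X :: "nat \<Rightarrow> nat" and i
    using inj_eq[OF inj_rotate_symbol[of p]] by auto
  have "sparse p G (rotate_vec p X) \<longleftrightarrow> sparse p G X" for G and X :: "nat \<Rightarrow> nat"
  proof -
    have "sparse p G (rotate_vec p X) \<longleftrightarrow>
        (\<forall>i \<in> rotate_symbol p ` {1..p}. \<forall>B \<in> G. \<not> B \<subseteq> {j. rotate_vec p X j = i})"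
      by (simp only: sparse_def rotate_symbol_image)
    also have "\<dots> \<longleftrightarrow> sparse p G X"
      by (simp only: sparse_def ball_simps rot)
    finally show ?thesis .
  qed
  then have K_rot: "K (rotate_vec p X) = K X" for X
    by (simp only: K_def)
  have S_rot: "S (rotate_vec p X) = rotate_symbol p ` S X" for X
  proof -
    have "S (rotate_vec p X) = {i \<in> rotate_symbol p ` {1..p}.
        \<exists>B \<in> F (Max (K X)). B \<subseteq> {j. rotate_vec p X j = i}}"
      by (simp only: S_def K_rot rotate_symbol_image)
    also have "\<dots> = rotate_symbol p ` {i \<in> {1..p}.
        \<exists>B \<in> F (Max (K X)). B \<subseteq> {j. rotate_vec p X j = rotate_symbol p i}}"
      by blast
    finally show ?thesis
      by (simp only: rot S_def)
  qed
  have rot_mod: "[int (rotate_symbol p i) = int i + 1] (mod int p)" if "i \<in> {1..p}" for i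
    using that by (auto simp: rotate_symbol_def cong_def add.commute)
  have s_rot: "s (rotate_vec p X) mod int p = (s X + 1) mod int p"
    if X: "X \<in> partial_vecs p V" "X \<noteq> (\<lambda>_. 0)" for X
  proof (cases "K X = {}")
    case True
    have "Min (supp X) \<in> supp X"
      using fin[OF X(1)] X(2) by (simp add: supp_eq_empty)
    then have "X (Min (supp X)) \<in> {1..p}"
      using X(1) by (auto simp: supp_def partial_vecs_def Suc_le_eq)
    with rot_mod True show ?thesis
      by (simp add: s_def K_rot cong_def)
  next
    case False
    let ?m = "card (S X)"
    have inj: "inj_on (rotate_symbol p) (S X)"
      using inj_rotate_symbol inj_on_subset by blast
    have card_S: "card (S (rotate_vec p X)) = ?m"
      by (simp only: S_rot card_image[OF inj])
    have s_X: "s X = a ?m * (\<Sum>i \<in> S X. int i)"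
      "s (rotate_vec p X) = a ?m * (\<Sum>i \<in> S (rotate_vec p X). int i)"
      by (simp_all only: s_def K_rot card_S False if_False)
    have "(\<Sum>i \<in> S (rotate_vec p X). int i) = (\<Sum>i \<in> S X. int (rotate_symbol p i))"
      by (simp add: S_rot sum.reindex[OF inj])
    also have "[\<dots> = (\<Sum>i \<in> S X. int i + 1)] (mod int p)"
      using rot_mod by (intro cong_sum) (auto simp: S_def)
    also have "(\<Sum>i \<in> S X. int i + 1) = (\<Sum>i \<in> S X. int i) + int ?m"
      by (simp add: sum.distrib)
    finally have "[a ?m * (\<Sum>i \<in> S (rotate_vec p X). int i)
        = a ?m * ((\<Sum>i \<in> S X. int i) + int ?m)] (mod int p)"
      by (rule cong_scalar_left)
    also have "a ?m * ((\<Sum>i \<in> S X. int i) + int ?m) = a ?m * (\<Sum>i \<in> S X. int i) + a ?m * int ?m"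
      by (simp add: distrib_left)
    also have "[\<dots> = a ?m * (\<Sum>i \<in> S X. int i) + 1] (mod int p)"
      using S_card[OF False X(1)] p2 by (intro cong_add a[rule_format]) auto
    finally show ?thesis
      unfolding cong_def s_X .
  qed
  have ht_pos: "0 < ht X" if X: "X \<in> partial_vecs p V" "X \<noteq> (\<lambda>_. 0)" for X
    using S_card(1)[OF _ X(1)] max_alt_pos[OF fin[OF X(1)] X(2)] by (auto simp: ht_def)
  have ht_mono: "ht X \<le> ht Y \<and> (ht X = ht Y \<longrightarrow> s X = s Y)"
    if X: "X \<in> partial_vecs p V" and Y: "Y \<in> partial_vecs p V" and X0: "X \<noteq> (\<lambda>_. 0)"
      and XY: "X \<sqsubset> Y" for X Y
  proof (cases "K X = {}")
    case KX: True
    show ?thesis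
    proof (cases "K Y = {}")
      case True
      with KX show ?thesis
        using max_alt_mono[OF XY fin[OF Y]] max_alt_eq_imp_first_eq[OF XY fin[OF Y] X0]
        by (simp add: ht_def s_def)
    next
      case False
      with KX sparse_le[OF KX X] S_card(1)[OF False Y] show ?thesis
        by (simp add: ht_def)
    qed
  next
    case KX: False
    then have KY: "K Y \<noteq> {}"
      using K_mono[OF XY] by auto
    have le: "Max (K X) \<le> Max (K Y)"
      using K_mono[OF XY] KX finK by (intro Max_mono)
    show ?thesis
    proof (cases "Max (K X) = Max (K Y)")
      case True
      \<comment> \<open>By inclusion, equal cardinalities force \<open>S X = S Y\<close> and thus
        equal labels.\<close>
      note sub = S_mono[OF XY True]
      have "card (S X) \<le> card (S Y)"
        using sub finS by (intro card_mono)
      moreover have "S X = S Y" if "card (S X) = card (S Y)"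
        using sub finS that by (intro card_subset_eq)
      ultimately show ?thesis
        using KX KY True by (auto simp: ht_def s_def)
    next
      case False
      \<comment> \<open>\<open>S X\<close> fills at most its own block of \<open>p - 1\<close>
        heights, while \<open>S Y\<close> reaches at least one step into a later block.\<close>
      with le have "Suc (Max (K X)) * (p - 1) \<le> Max (K Y) * (p - 1)"
        by (intro mult_right_mono) auto
      then have "ht X < ht Y"
        using KX KY S_card(2)[OF KX X] S_card(1)[OF KY Y] by (simp add: ht_def)
      then show ?thesis by simp
    qed
  qed
  obtain X where X: "X \<in> partial_vecs p V" "X \<noteq> (\<lambda>_. 0)" "card V \<le> ht X"
    using equivariant_height_bound[where s = s and ht = ht, OF p2 V \<open>V \<noteq> {}\<close> s_rot ht_pos ht_mono]
    by blast
  show False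
  proof (cases "K X = {}")
    case True
    with sparse_le[OF True X(1)] X(3) c show False
      by (simp add: ht_def)
  next
    case False
    have "Suc (Max (K X)) * (p - 1) \<le> C * (p - 1)"
      using MaxK[OF False] by (intro mult_right_mono) (auto simp: K_def)
    with False S_card(2)[OF False X(1)] X(3) c show False
      by (simp add: ht_def mult.commute)
  qed
qed

section \<open>Products and arbitrary \<open>r\<close>\<close>

text \<open>Apply the bound for \<open>b\<close> to the families of sets that contain \<open>a\<close> disjoint members, then the
  bound for \<open>a\<close> inside each colour class.\<close>

lemma alternation_bound_mult:
  assumes a: "alternation_bound a" "1 \<le> a" and b: "alternation_bound b" "1 \<le> b"
  shows "alternation_bound (a * b)"
  unfolding alternation_bound_def
proof (intro allI impI)
  fix V :: "nat set" and C :: nat and F :: "nat \<Rightarrow> nat set set"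
  assume V: "finite V" and F: "\<forall>k<C. {} \<notin> F k \<and> \<not> packs (a * b) (F k) V"
  \<comment> \<open>Division with remainder shifted to start at \<open>1\<close>:
    \<open>x = (q x - 1) * a + m x\<close>.\<close>
  define q m where "q x = (x - 1) div a + 1" and "m x = (x - 1) mod a + 1" for x
  have q: "q x \<in> {1..b}" and m: "m x \<in> {1..a}" if "x \<in> {1..a * b}" for x
  proof -
    have "x - 1 < b * a"
      using that by (auto simp: mult.commute)
    then have "(x - 1) div a < b"
      by (rule less_mult_imp_div_less)
    then show "q x \<in> {1..b}"
      by (simp add: q_def)
    show "m x \<in> {1..a}"
      using a(2) by (simp add: m_def Suc_le_eq)
  qed
  have qm_inj: "x = y" if "x \<in> {1..a * b}" "y \<in> {1..a * b}" "q x = q y" "m x = m y" for x y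
  proof -
    have "(x - 1) div a = (y - 1) div a" "(x - 1) mod a = (y - 1) mod a"
      using that(3,4) by (simp_all add: q_def m_def)
    then have "x - 1 = y - 1"
      by (metis div_mult_mod_eq)
    then show ?thesis
      using that(1,2) by auto
  qed
  define G where "G k = {A. packs a (F k) A}" for k
  have G: "{} \<notin> G k" "\<not> packs b (G k) V" if k: "k < C" for k
  proof -
    show "{} \<notin> G k"
    proof
      assume "{} \<in> G k"
      then obtain W where "\<forall>i \<in> {1..a}. W i \<in> F k \<and> W i \<subseteq> {}"
        unfolding G_def packs_def by blast
      moreover have "1 \<in> {1..a}"
        using a(2) by simp
      ultimately have "{} \<in> F k"
        by (metis subset_empty)
      with F k show False by blast
    qed
    show "\<not> packs b (G k) V"
    proof
      assume "packs b (G k) V"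
      then obtain W where "\<forall>i \<in> {1..b}. W i \<in> G k \<and> W i \<subseteq> V" "disjoint_family_on W {1..b}"
        unfolding packs_def by blast
      then have W: "\<And>i. i \<in> {1..b} \<Longrightarrow> packs a (F k) (W i) \<and> W i \<subseteq> V"
          "disjoint_family_on W {1..b}"
        unfolding G_def by blast+
      have "\<exists>U. (\<forall>l \<in> {1..a}. U l \<in> F k \<and> U l \<subseteq> W i) \<and> disjoint_family_on U {1..a}"
        if "i \<in> {1..b}" for i
        using W(1)[OF that] by (simp add: packs_def)
      then obtain U where U: "\<And>i l. i \<in> {1..b} \<Longrightarrow> l \<in> {1..a} \<Longrightarrow> U i l \<in> F k \<and> U i l \<subseteq> W i"
          "\<And>i. i \<in> {1..b} \<Longrightarrow> disjoint_family_on (U i) {1..a}"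
        by metis
      have "packs (a * b) (F k) V"
        unfolding packs_def
      proof (intro exI[of _ "\<lambda>x. U (q x) (m x)"] conjI ballI)
        fix x assume x: "x \<in> {1..a * b}"
        show "U (q x) (m x) \<in> F k"
          using U(1)[OF q[OF x] m[OF x]] by simp
        show "U (q x) (m x) \<subseteq> V"
          using U(1)[OF q[OF x] m[OF x]] W(1)[OF q[OF x]] by blast
      next
        show "disjoint_family_on (\<lambda>x. U (q x) (m x)) {1..a * b}"
          unfolding disjoint_family_on_def
        proof (intro ballI impI)
          fix x y assume xy: "x \<in> {1..a * b}" "y \<in> {1..a * b}" "x \<noteq> y"
          show "U (q x) (m x) \<inter> U (q y) (m y) = {}"
          proof (cases "q x = q y")
            case True
            then have "m x \<noteq> m y"
              using qm_inj xy by blast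
            with True show ?thesis
              using disjoint_family_onD[OF U(2)[OF q[OF xy(2)]] m[OF xy(1)] m[OF xy(2)]] by simp
          next
            case False
            then have "W (q x) \<inter> W (q y) = {}"
              using disjoint_family_onD[OF W(2) q[OF xy(1)] q[OF xy(2)]] by simp
            moreover have "U (q x) (m x) \<subseteq> W (q x)" "U (q y) (m y) \<subseteq> W (q y)"
              using U(1)[OF q m] xy by auto
            ultimately show ?thesis by blast
          qed
        qed
      qed
      with F k show False by blast
    qed
  qed
  obtain X where X: "X \<in> partial_vecs b V" "\<And>k. k < C \<Longrightarrow> sparse b (G k) X"
      "card V \<le> card (supp X) + (b - 1) * C"
    using alternation_boundE[where F = G, OF b(1) V G] by metis
  define Vi where "Vi i = {j. X j = i}" for i
  have Vi: "Vi i \<subseteq> V" if "i \<in> {1..b}" for i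
    using that X(1) by (auto simp: Vi_def partial_vecs_def)
  have fin_Vi: "finite (Vi i)" if "i \<in> {1..b}" for i
    by (rule finite_subset[OF Vi[OF that] V])
  have "\<exists>Y \<in> partial_vecs a (Vi i). alternating_on Y (supp Y) \<and> (\<forall>k<C. sparse a (F k) Y) \<and>
      card (Vi i) \<le> card (supp Y) + (a - 1) * C" if i: "i \<in> {1..b}" for i
  proof -
    \<comment> \<open>As \<open>X\<close> is sparse for \<open>G k\<close>, no class of
      \<open>X\<close> contains \<open>a\<close> disjoint members of \<open>F k\<close>.\<close>
    have Fk: "{} \<notin> F k" "\<not> packs a (F k) (Vi i)" if "k < C" for k
    proof -
      show "{} \<notin> F k"
        using F that by blast
      show "\<not> packs a (F k) (Vi i)"
        using X(2)[OF that] i unfolding sparse_def G_def Vi_def by blast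
    qed
    show ?thesis
      using alternation_boundE[where F = F, OF a(1) fin_Vi[OF i] Fk] by metis
  qed
  then obtain Y where Y: "\<And>i. i \<in> {1..b} \<Longrightarrow> Y i \<in> partial_vecs a (Vi i)"
      "\<And>i. i \<in> {1..b} \<Longrightarrow> alternating_on (Y i) (supp (Y i))"
      "\<And>i k. i \<in> {1..b} \<Longrightarrow> k < C \<Longrightarrow> sparse a (F k) (Y i)"
      "\<And>i. i \<in> {1..b} \<Longrightarrow> card (Vi i) \<le> card (supp (Y i)) + (a - 1) * C"
    by metis
  have X_le: "X j \<le> b" for j
    using X(1) by (auto simp: partial_vecs_def)
  have Y_le: "Y i j \<le> a" if "i \<in> {1..b}" for i j
    using Y(1)[OF that] by (auto simp: partial_vecs_def)
  have Y_X: "X j = i" if "i \<in> {1..b}" "Y i j \<noteq> 0" for i j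
    using Y(1)[OF that(1)] that(2) unfolding partial_vecs_def Vi_def by blast
  \<comment> \<open>The class in \<open>X\<close> and the symbol in the \<open>Y\<close> of that
    class are joined into one symbol, inverting \<open>q\<close> and \<open>m\<close>.\<close>
  define Z where "Z j = (if X j = 0 \<or> Y (X j) j = 0 then 0 else (X j - 1) * a + Y (X j) j)" for j
  have Z_nz: "X j \<in> {1..b}" "Y (X j) j \<in> {1..a}" "q (Z j) = X j" "m (Z j) = Y (X j) j"
    "Z j \<in> {1..a * b}" if "Z j \<noteq> 0" for j
  proof -
    have nz: "X j \<noteq> 0" "Y (X j) j \<noteq> 0"
      using that by (auto simp: Z_def split: if_splits)
    then show Xj: "X j \<in> {1..b}"
      using X_le by (simp add: Suc_le_eq)
    then show Yj: "Y (X j) j \<in> {1..a}"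
      using nz Y_le by (simp add: Suc_le_eq)
    obtain x y where xy: "X j = Suc x" "Y (Suc x) j = Suc y"
      using nz by (metis not0_implies_Suc)
    then have "Z j - 1 = x * a + y" "y < a"
      using Yj by (auto simp: Z_def)
    then show "q (Z j) = X j" "m (Z j) = Y (X j) j"
      unfolding q_def m_def by (simp_all add: xy)
    have "Suc x * a \<le> b * a"
      using Xj xy by (intro mult_right_mono) auto
    with that \<open>y < a\<close> show "Z j \<in> {1..a * b}"
      by (auto simp: Z_def xy mult.commute)
  qed
  have supp_Y: "supp (Y i) \<subseteq> supp Z" if "i \<in> {1..b}" for i
    using Y_X[OF that] that by (auto simp: supp_def Z_def)
  have Z_in: "Z \<in> partial_vecs (a * b) V"
    unfolding partial_vecs_def
  proof (intro CollectI allI conjI impI)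
    show "Z j \<le> a * b" for j
      using Z_nz(5)[of j] by (cases "Z j = 0") auto
    show "j \<in> V" if "Z j \<noteq> 0" for j
      using Vi[OF Z_nz(1)[OF that]] by (auto simp: Vi_def)
  qed
  \<comment> \<open>Neighbours in \<open>supp Z\<close> with equal symbols lie in one class of
    \<open>X\<close> and have equal symbols in its \<open>Y\<close>. Since \<open>supp Z\<close>
    contains the support of that \<open>Y\<close>, they are neighbours there too, contradicting its
    alternation.\<close>
  have "alternating_on Z (supp Z)"
    unfolding alternating_on_def
  proof (intro ballI impI notI)
    fix x y
    assume xy: "x \<in> supp Z" "y \<in> supp Z" "x < y" "Z x = Z y"
      and between: "\<forall>z \<in> supp Z. \<not> (x < z \<and> z < y)"
    have nz: "Z x \<noteq> 0" "Z y \<noteq> 0"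
      using xy by (auto simp: supp_def)
    let ?i = "X x"
    have i: "?i \<in> {1..b}" and eq: "X y = ?i" "Y ?i x = Y ?i y"
      using Z_nz[OF nz(1)] Z_nz[OF nz(2)] xy(4) by auto
    have "x \<in> supp (Y ?i)" "y \<in> supp (Y ?i)"
      using Z_nz(2)[OF nz(1)] eq by (auto simp: supp_def)
    with Y(2)[OF i] eq(2) xy(3) between supp_Y[OF i] show False
      unfolding alternating_on_def by blast
  qed
  moreover have "sparse (a * b) (F k) Z" if k: "k < C" for k
    unfolding sparse_def
  proof (intro ballI notI)
    fix x B
    assume x: "x \<in> {1..a * b}" and B: "B \<in> F k" "B \<subseteq> {j. Z j = x}"
    have "Y (q x) j = m x" if "j \<in> B" for j
    proof -
      have Zj: "Z j = x"
        using that B(2) by blast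
      moreover have "Z j \<noteq> 0"
        using x Zj by simp
      ultimately show ?thesis
        using Z_nz(3,4)[of j] by simp
    qed
    then have "B \<subseteq> {j. Y (q x) j = m x}" by blast
    with Y(3)[OF q[OF x] k] m[OF x] B(1) show False
      unfolding sparse_def by blast
  qed
  moreover have "card V \<le> card (supp Z) + (a * b - 1) * C"
  proof -
    have "supp X = (\<Union>i \<in> {1..b}. Vi i)"
      using X_le by (auto simp: supp_def Vi_def Suc_le_eq)
    then have "card (supp X) = (\<Sum>i \<in> {1..b}. card (Vi i))"
      using fin_Vi by (simp only:) (subst card_UN_disjoint, auto simp: Vi_def)
    also have "\<dots> \<le> (\<Sum>i \<in> {1..b}. card (supp (Y i)) + (a - 1) * C)"
      using Y(4) by (rule sum_mono)
    also have "\<dots> = (\<Sum>i \<in> {1..b}. card (supp (Y i))) + b * ((a - 1) * C)"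
      by (simp add: sum.distrib)
    also have "(\<Sum>i \<in> {1..b}. card (supp (Y i))) = card (\<Union>i \<in> {1..b}. supp (Y i))"
    proof (rule card_UN_disjoint[symmetric])
      show "\<forall>i \<in> {1..b}. finite (supp (Y i))"
        by (intro ballI finite_subset[OF supp_subset[OF Y(1)] fin_Vi])
      show "\<forall>i \<in> {1..b}. \<forall>j \<in> {1..b}. i \<noteq> j \<longrightarrow> supp (Y i) \<inter> supp (Y j) = {}"
      proof (intro ballI impI)
        show "supp (Y i) \<inter> supp (Y j) = {}"
          if "i \<in> {1..b}" "j \<in> {1..b}" "i \<noteq> j" for i j
          using Y_X[OF that(1)] Y_X[OF that(2)] that(3) unfolding supp_def by blast
      qed
    qed simp
    also have "\<dots> \<le> card (supp Z)"
      by (intro card_mono UN_least supp_Y finite_subset[OF supp_subset[OF Z_in] V])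
    finally have "card V \<le> card (supp Z) + (b * ((a - 1) * C) + (b - 1) * C)"
      using X(3) by simp
    \<comment> \<open>Each of the \<open>b\<close> classes loses at most \<open>(a - 1) * C\<close>
      entries and \<open>X\<close> at most \<open>(b - 1) * C\<close>.\<close>
    also have "b * ((a - 1) * C) + (b - 1) * C = (a * b - 1) * C"
      using a(2) b(2) by (cases a; cases b) (auto simp: algebra_simps)
    finally show ?thesis .
  qed
  ultimately show "\<exists>X \<in> partial_vecs (a * b) V. alternating_on X (supp X) \<and>
      (\<forall>k<C. sparse (a * b) (F k) X) \<and> card V \<le> card (supp X) + (a * b - 1) * C"
    using Z_in by blast
qed

theorem alternation_bound: "2 \<le> r \<Longrightarrow> alternation_bound r"
proof (induction r rule: less_induct)
  case (less r)
  obtain p where p: "prime p" "p dvd r"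
    using prime_factor_nat[of r] less.prems by auto
  then obtain m where m: "r = p * m" by (auto elim: dvdE)
  show ?case
  proof (cases "m = 1")
    case True
    with p m show ?thesis by (simp add: alternation_bound_prime)
  next
    case False
    have p2: "2 \<le> p"
      using p(1) by (rule prime_ge_2_nat)
    have "0 < m"
      using m less.prems by (cases m) auto
    with False have "2 \<le> m" "m < r"
      using p2 m by auto
    then show ?thesis
      using less.IH[of m] alternation_bound_mult[OF alternation_bound_prime[OF p(1)], of m] p2 m
      by simp
  qed
qed

section \<open>Colourings of Kneser hypergraphs\<close>

lemma finite_alternating_lengths:
  "finite {length js | js. sorted_wrt (<) js \<and> set js \<subseteq> {1..n :: nat} \<and>
     (\<forall>j \<in> set js. X j \<noteq> 0) \<and> distinct_adj (map X js)}"
proof (rule finite_subset)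
  show "{length js | js. sorted_wrt (<) js \<and> set js \<subseteq> {1..n} \<and>
     (\<forall>j \<in> set js. X j \<noteq> 0) \<and> distinct_adj (map X js)} \<subseteq> {..n}"
  proof clarify
    fix js :: "nat list"
    assume js: "sorted_wrt (<) js" "set js \<subseteq> {1..n}"
    have "length js = card (set js)"
      using js(1) strict_sorted_iff[of js] by (simp add: distinct_card)
    also have "\<dots> \<le> card {1..n}"
      using js(2) by (intro card_mono) auto
    finally show "length js \<le> n" by simp
  qed
qed simp

lemma alternating_on_imp_distinct_adj:
  assumes "alternating_on X A" and "finite A"
  shows "distinct_adj (map X (sorted_list_of_set A))"
proof -
  let ?js = "sorted_list_of_set A"
  have lt: "?js ! i < ?js ! j \<longleftrightarrow> i < j" if "i < length ?js" "j < length ?js" for i j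
    using that sorted_wrt_nth_less[OF strict_sorted_list_of_set[of A]]
    by (metis less_asym linorder_neqE_nat)
  have "X (?js ! i) \<noteq> X (?js ! Suc i)" if i: "Suc i < length ?js" for i
  proof -
    have mem: "?js ! i \<in> A" "?js ! Suc i \<in> A"
      using i assms(2) by (metis Suc_lessD nth_mem set_sorted_list_of_set)+
    have "\<not> (?js ! i < z \<and> z < ?js ! Suc i)" if "z \<in> A" for z
    proof -
      have "z \<in> set ?js"
        using that assms(2) by simp
      then obtain k where "k < length ?js" "z = ?js ! k"
        by (metis in_set_conv_nth)
      with i lt show ?thesis by auto
    qed
    with mem i lt[of i "Suc i"] assms(1) show ?thesis
      by (auto simp: alternating_on_def)
  qed
  then show ?thesis
    by (auto simp: distinct_adj_conv_nth)
qed

lemma card_le_alt: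
  assumes "alternating_on X A" and "A \<subseteq> {1..n}" and "\<And>a. a \<in> A \<Longrightarrow> X a \<noteq> 0"
  shows "card A \<le> alt n X"
  unfolding alt_def
proof (rule Max_ge[OF finite_alternating_lengths])
  have "finite A"
    using assms(2) finite_subset by blast
  then show "card A \<in> {length js | js. sorted_wrt (<) js \<and> set js \<subseteq> {1..n} \<and>
     (\<forall>j \<in> set js. X j \<noteq> 0) \<and> distinct_adj (map X js)}"
    using assms alternating_on_imp_distinct_adj[OF assms(1)]
    by (intro CollectI exI[of _ "sorted_list_of_set A"]) auto
qed

lemma alt_le_alt_number:
  assumes "card (verts H) = n" and "X \<in> {1..n} \<rightarrow>\<^sub>E {0..r}"
    and "\<And>i. i \<in> {1..r} \<Longrightarrow> card (edges (induced H (\<sigma> ` {j \<in> {1..n}. X j = i}))) \<le> q - 1"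
  shows "alt n X \<le> alt_number r H \<sigma> q"
proof -
  have "finite {alt n X | X. X \<in> {1..n} \<rightarrow>\<^sub>E {0..r} \<and>
       (\<forall>i \<in> {1..r}. card (edges (induced H (\<sigma> ` {j \<in> {1..n}. X j = i}))) \<le> q - 1)}"
    by (rule finite_subset[of _ "alt n ` ({1..n} \<rightarrow>\<^sub>E {0..r})"]) (auto intro!: finite_PiE)
  then show ?thesis
    unfolding alt_number_def Let_def assms(1) using assms(2,3) by (intro Max_ge) auto
qed

theorem theorem4:
  fixes H :: "'a hypergraph" and \<sigma> :: "nat \<Rightarrow> 'a" and c :: "'a set \<Rightarrow> 'c"
    and n d q r t :: nat
  assumes "hypergraph H"
    and "card (verts H) = n"
    and "bij_betw \<sigma> {1..n} (verts H)"
    and "d \<ge> 1" and "q \<ge> 1" and "t \<ge> 1" and "r \<ge> 2"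
    and "q \<ge> (d - 1) * (t - 1) + 1"
    and "\<not> (\<exists>W. complete_partite_sub r t (KG r H) W \<and>
                monochromatic c (\<Union>i \<in> {1..r}. W i))"
  shows "int (card (c ` verts (KG r H))) \<ge>
     min \<lceil>(real n - real (alt_number r H \<sigma> q)) / (real r - 1)\<rceil> (int d)"
proof -
  define C where "C = card (c ` edges H)"
  have KG_verts: "verts (KG r H) = edges H"
    by (simp add: KG_def)
  have edge: "e \<noteq> {}" "e \<subseteq> verts H" if "e \<in> edges H" for e
    using assms(1) that by (auto simp: hypergraph_def)
  have fin_E: "finite (edges H)"
    using assms(1) by (auto simp: hypergraph_def intro: finite_subset[of _ "Pow (verts H)"])
  show ?thesis
  proof (cases "d \<le> C")
    case True
    then show ?thesis
      by (simp add: KG_verts C_def min_le_iff_disj)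
  next
    case False
    obtain col where col: "bij_betw col {0..<C} (c ` edges H)"
      using ex_bij_betw_nat_finite[of "c ` edges H"] fin_E by (auto simp: C_def)
    define F where "F k = {B. \<exists>T \<subseteq> edges H. card T = t \<and> (\<forall>e \<in> T. c e = col k \<and> e \<subseteq> \<sigma> ` B)}" for k
    have F_ne: "{} \<notin> F k" for k
    proof
      assume "{} \<in> F k"
      then obtain T where T: "T \<subseteq> edges H" "card T = t" "\<forall>e \<in> T. e \<subseteq> {}"
        by (auto simp: F_def)
      then have "T \<noteq> {}"
        using \<open>t \<ge> 1\<close> by auto
      with T edge(1) show False by blast
    qed
    \<comment> \<open>Disjoint index sets have disjoint images under the bijection, so edges of
      colour \<open>col k\<close> chosen inside them would form the forbidden monochromatic
      subhypergraph.\<close>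
    have F_packs: "\<not> packs r (F k) {1..n}" for k
    proof
      assume "packs r (F k) {1..n}"
      then obtain B where "\<forall>i \<in> {1..r}. B i \<in> F k \<and> B i \<subseteq> {1..n}" "disjoint_family_on B {1..r}"
        unfolding packs_def by blast
      then have B: "\<And>i. i \<in> {1..r} \<Longrightarrow> B i \<in> F k" "\<And>i. i \<in> {1..r} \<Longrightarrow> B i \<subseteq> {1..n}"
          "disjoint_family_on B {1..r}"
        by blast+
      have "\<exists>T. T \<subseteq> edges H \<and> card T = t \<and> (\<forall>e \<in> T. c e = col k \<and> e \<subseteq> \<sigma> ` B i)"
        if "i \<in> {1..r}" for i
        using B(1)[OF that] by (auto simp: F_def)
      then obtain T where T: "\<And>i. i \<in> {1..r} \<Longrightarrow> T i \<subseteq> edges H" "\<And>i. i \<in> {1..r} \<Longrightarrow> card (T i) = t"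
          "\<And>i e. i \<in> {1..r} \<Longrightarrow> e \<in> T i \<Longrightarrow> c e = col k \<and> e \<subseteq> \<sigma> ` B i"
        by metis
      have disj: "e \<inter> e' = {}"
        if "i \<in> {1..r}" "j \<in> {1..r}" "i \<noteq> j" "e \<in> T i" "e' \<in> T j" for i j e e'
      proof -
        have "\<sigma> ` B i \<inter> \<sigma> ` B j = \<sigma> ` (B i \<inter> B j)"
          using assms(3) B(2) that
          by (intro inj_on_image_Int[symmetric, of _ "{1..n}"]) (auto simp: bij_betw_def)
        also have "B i \<inter> B j = {}"
          using disjoint_family_onD[OF B(3)] that by blast
        finally have "\<sigma> ` B i \<inter> \<sigma> ` B j = {}" by simp
        with T(3)[OF that(1,4)] T(3)[OF that(2,5)] show ?thesis by blast
      qed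
      \<comment> \<open>Disjoint nonempty edges are distinct: this gives disjoint parts
        \<open>T i\<close> and \<open>r\<close> different edges in every transversal.\<close>
      have ne: "e \<noteq> {}" if "i \<in> {1..r}" "e \<in> T i" for i e
        using T(1)[OF that(1)] that(2) edge(1) by blast
      have "complete_partite_sub r t (KG r H) T"
        unfolding complete_partite_sub_def
      proof (intro conjI ballI allI impI)
        fix i assume i: "i \<in> {1..r}"
        show "T i \<subseteq> verts (KG r H)" "finite (T i)" "card (T i) = t"
          using T(1,2)[OF i] finite_subset[OF _ fin_E] by (auto simp: KG_verts)
      next
        show "disjoint_family_on T {1..r}"
          unfolding disjoint_family_on_def
        proof (intro ballI impI)
          fix i j assume "i \<in> {1..r}" "j \<in> {1..r}" "i \<noteq> j"
          then show "T i \<inter> T j = {}"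
            using disj[of i j] ne[of i] by blast
        qed
      next
        fix w assume w: "\<forall>i \<in> {1..r}. w i \<in> T i"
        have wd: "w i \<inter> w j = {}" "w i \<noteq> {}" if "i \<in> {1..r}" "j \<in> {1..r}" "i \<noteq> j" for i j
          using disj[OF that] ne[OF that(1)] w that by auto
        have "inj_on w {1..r}"
        proof (rule inj_onI, rule ccontr)
          fix i j assume "i \<in> {1..r}" "j \<in> {1..r}" "w i = w j" "i \<noteq> j"
          then show False
            using wd[of i j] by simp
        qed
        then have "card (w ` {1..r}) = r"
          by (simp add: card_image)
        moreover have "pairwise disjnt (w ` {1..r})"
        proof (rule pairwiseI)
          fix e e' assume "e \<in> w ` {1..r}" "e' \<in> w ` {1..r}" "e \<noteq> e'"
          then obtain i j where ij: "i \<in> {1..r}" "j \<in> {1..r}" "e = w i" "e' = w j" "i \<noteq> j"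
            by blast
          then show "disjnt e e'"
            using wd(1)[OF ij(1,2,5)] by (simp add: disjnt_def)
        qed
        moreover have "w ` {1..r} \<subseteq> edges H"
          using w T(1) by blast
        ultimately show "w ` {1..r} \<in> edges (KG r H)"
          by (simp add: KG_def)
      qed
      moreover have "monochromatic c (\<Union>i \<in> {1..r}. T i)"
        unfolding monochromatic_def using T(3) by (intro exI[of _ "col k"]) blast
      ultimately show False
        using assms(9) by blast
    qed
    obtain X where X: "X \<in> partial_vecs r {1..n}" "alternating_on X (supp X)"
        "\<And>k. k < C \<Longrightarrow> sparse r (F k) X" "card {1..n} \<le> card (supp X) + (r - 1) * C"
      using alternation_boundE[where F = F, OF alternation_bound[OF \<open>r \<ge> 2\<close>] finite_atLeastAtMost
          F_ne F_packs] by metis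
    \<comment> \<open>\<open>alt_number\<close> ranges over extensional functions; entries at
      \<open>{1..n}\<close> are unchanged.\<close>
    define X' where "X' = restrict X {1..n}"
    have supp_X: "supp X \<subseteq> {1..n}"
      by (rule supp_subset[OF X(1)])
    have "card (edges (induced H (\<sigma> ` {j \<in> {1..n}. X' j = i}))) \<le> q - 1" if i: "i \<in> {1..r}" for i
    proof -
      let ?B = "{j. X j = i}"
      have "{j \<in> {1..n}. X' j = i} = ?B"
        using i X(1) by (auto simp: X'_def partial_vecs_def)
      then have "edges (induced H (\<sigma> ` {j \<in> {1..n}. X' j = i})) = {e \<in> edges H. e \<subseteq> \<sigma> ` ?B}"
        by (simp add: induced_def)
      \<comment> \<open>The edges are counted colour by colour. Each colour contributes fewer than
        \<open>t\<close>, since otherwise \<open>?B\<close> itself would belong to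
        \<open>F k\<close>.\<close>
      also have "\<dots> = (\<Union>k \<in> {0..<C}. {e \<in> edges H. c e = col k \<and> e \<subseteq> \<sigma> ` ?B})"
      proof -
        have "\<exists>k \<in> {0..<C}. c e = col k" if "e \<in> edges H" for e
        proof -
          have "c e \<in> col ` {0..<C}"
            using that bij_betw_imp_surj_on[OF col] by simp
          then show ?thesis by blast
        qed
        then show ?thesis by blast
      qed
      also have "card \<dots> \<le> (\<Sum>k \<in> {0..<C}. card {e \<in> edges H. c e = col k \<and> e \<subseteq> \<sigma> ` ?B})"
        by (rule card_UN_le) simp
      also have "\<dots> \<le> (\<Sum>k \<in> {0..<C}. t - 1)"
      proof (rule sum_mono)
        fix k assume "k \<in> {0..<C}"
        then have "sparse r (F k) X"
          using X(3) by simp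
        then have notF: "?B \<notin> F k"
          using i unfolding sparse_def by blast
        let ?D = "{e \<in> edges H. c e = col k \<and> e \<subseteq> \<sigma> ` ?B}"
        have "\<not> t \<le> card ?D"
        proof
          assume "t \<le> card ?D"
          then obtain T where T: "T \<subseteq> ?D" "card T = t" "finite T"
            by (rule obtain_subset_with_card_n)
          then have "T \<subseteq> edges H" "\<forall>e \<in> T. c e = col k \<and> e \<subseteq> \<sigma> ` ?B"
            by auto
          with T(2) have "?B \<in> F k"
            unfolding F_def by (intro CollectI exI[of _ T] conjI)
          with notF show False ..
        qed
        then show "card ?D \<le> t - 1" by simp
      qed
      also have "\<dots> = C * (t - 1)" by simp
      also have "\<dots> \<le> (d - 1) * (t - 1)"
        using False by (intro mult_right_mono) auto
      also have "\<dots> \<le> q - 1"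
        using assms(8) by simp
      finally show ?thesis .
    qed
    moreover have "X' \<in> {1..n} \<rightarrow>\<^sub>E {0..r}"
      using X(1) by (auto simp: X'_def partial_vecs_def)
    ultimately have "alt n X' \<le> alt_number r H \<sigma> q"
      by (intro alt_le_alt_number assms(2))
    moreover have "card (supp X) \<le> alt n X'"
    proof (rule card_le_alt)
      have eq: "X a = X' a" if "a \<in> supp X" for a
        using that supp_X by (auto simp: X'_def)
      show "alternating_on X' (supp X)"
        by (rule iffD1[OF alternating_on_cong[OF eq] X(2)])
      show "X' a \<noteq> 0" if "a \<in> supp X" for a
        using that eq[OF that] by (simp add: supp_def)
    qed (rule supp_X)
    ultimately have "n \<le> alt_number r H \<sigma> q + (r - 1) * C"
      using X(4) by simp
    then have "real n \<le> real (alt_number r H \<sigma> q + (r - 1) * C)"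
      by (simp only: of_nat_le_iff)
    then have "real n - real (alt_number r H \<sigma> q) \<le> real C * (real r - 1)"
      using \<open>r \<ge> 2\<close> by (simp add: of_nat_diff mult.commute)
    then have "(real n - real (alt_number r H \<sigma> q)) / (real r - 1) \<le> real C"
      using \<open>r \<ge> 2\<close> by (simp add: divide_le_eq)
    then have "\<lceil>(real n - real (alt_number r H \<sigma> q)) / (real r - 1)\<rceil> \<le> int C"
      by (simp add: ceiling_le_iff)
    then show ?thesis
      by (simp add: KG_verts C_def min_le_iff_disj)
  qed
qed

end
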